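(* Let $m,n>-1/2$ and $\alpha_1,\alpha_2>0$. Let $X\sim\mathrm{VG}(m,\alpha_1,0,0)$ and $Y\sim\mathrm{VG}(n,\alpha_2,0,0)$ be independent, let $Z=X/Y$, and let $F_Z(z)=\mathbb{P}(Z\le z)$. Then, for $z\in\mathbb{R}$, $$F_Z(z)=\frac{1}{2}+\frac{\alpha_1z/\alpha_2}{2\pi\Gamma(m+1/2)\Gamma(n+1/2)}\,G^{2,3}_{3,3}\bigg(\frac{\alpha_1^2z^2}{\alpha_2^2}\,\bigg|\,{-n,\frac12,0 \atop m,0,-\frac12}\bigg),$$ where for $z=0$ the second term on the right-hand side is understood as its limiting value $0$.
   Context: For $m>-1/2$ and $\alpha>0$, a random variable $X$ has the (symmetric) variance-gamma distribution $\mathrm{VG}(m,\alpha,0,0)$ if it has probability density function $$f_X(x)=\frac{\alpha^{2m+1}}{\sqrt{\pi}(2\alpha)^m\Gamma(m+1/2)}|x|^mK_m(\alpha|x|),\quad x\in\mathbb{R},$$ where $K_m(x)=\int_0^\infty \mathrm{e}^{-x\cosh t}\cosh(mt)\,\mathrm{d}t$, $x>0$, is the modified Bessel function of the second kind. The Meijer $G$-function is defined by the contour integral $$G^{\mu,\nu}_{p,q}\bigg(x\,\bigg|\,{a_1,\ldots,a_p\atop b_1,\ldots,b_q}\bigg)=\frac{1}{2\pi \mathrm{i}}\int_L\frac{\prod_{j=1}^{\mu}\Gamma(b_j-s)\prod_{j=1}^{\nu}\Gamma(1-a_j+s)}{\prod_{j=\nu+1}^p\Gamma(a_j-s)\prod_{j=\mu+1}^q\Gamma(1-b_j+s)}x^s\,\mathrm{d}s,$$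 where the integration path $L$ (running from $-\mathrm{i}\infty$ to $\mathrm{i}\infty$) separates the poles of the factors $\Gamma(b_j-s)$ (to its right) from those of the factors $\Gamma(1-a_j+s)$ (to its left), and the empty product is $1$. *)

theory Defs
  imports "HOL-Probability.Probability" "HOL-Complex_Analysis.Complex_Analysis"
begin

text \<open>Modified Bessel function of the second kind (used for \<open>x > 0\<close> only).\<close>

definition bessel_K :: "real \<Rightarrow> real \<Rightarrow> real" where
  "bessel_K m x = (LBINT t:{0..}. exp (- x * cosh t) * cosh (m * t))"

text \<open>Density of \<open>VG(m, \<alpha>, 0, 0)\<close>. Its value at the single point \<open>x = 0\<close> (which is \<open>0\<close>
  here because \<open>0 powr m = 0\<close>) does not affect the distribution.\<close>

definition vg_density :: "real \<Rightarrow> real \<Rightarrow> real \<Rightarrow> real" where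
  "vg_density m \<alpha> x =
     \<alpha> powr (2 * m + 1) / (sqrt pi * (2 * \<alpha>) powr m * Gamma (m + 1/2))
       * \<bar>x\<bar> powr m * bessel_K m (\<alpha> * \<bar>x\<bar>)"

text \<open>Here \<open>p = length as\<close>, \<open>q = length bs\<close>, and list indices start at \<open>0\<close>, so \<open>as ! j\<close> is the
  parameter usually written with subscript \<open>j + 1\<close>. As \<open>Gamma\<close> is \<open>0\<close> at its poles and
  \<open>x / 0 = 0\<close>, the quotient vanishes at the poles of the denominator, as \<open>1 / \<Gamma>\<close> does.\<close>

definition meijer_integrand ::
  "nat \<Rightarrow> nat \<Rightarrow> complex list \<Rightarrow> complex list \<Rightarrow> complex \<Rightarrow> complex \<Rightarrow> complex" where
  "meijer_integrand \<mu> \<nu> as bs x s =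
     ((\<Prod>j<\<mu>. Gamma (bs ! j - s)) * (\<Prod>j<\<nu>. Gamma (1 - as ! j + s)))
     / ((\<Prod>j=\<nu>..<length as. Gamma (as ! j - s)) * (\<Prod>j=\<mu>..<length bs. Gamma (1 - bs ! j + s)))
     * x powr s"

text \<open>A path from \<open>-\<i>\<infinity>\<close> to \<open>\<i>\<infinity>\<close>, parametrised by the whole real line. The path \<open>\<gamma>\<close> restricted
  to \<open>[r, s]\<close> is \<open>subpath r s \<gamma>\<close>.\<close>

definition imag_infinity_path :: "(real \<Rightarrow> complex) \<Rightarrow> bool" where
  "imag_infinity_path \<gamma> \<longleftrightarrow>
     inj \<gamma> \<and> (\<forall>r s. r < s \<longrightarrow> valid_path (subpath r s \<gamma>)) \<and>
     bounded (range (\<lambda>t. Re (\<gamma> t))) \<and>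
     filterlim (\<lambda>t. Im (\<gamma> t)) at_bot at_bot \<and> filterlim (\<lambda>t. Im (\<gamma> t)) at_top at_top"

text \<open>Seen from a point \<open>z\<close> off the path, the argument of \<open>\<gamma> t - z\<close> changes in total by \<open>\<pi>\<close> if
  \<open>z\<close> lies to the left of the (upward) path and by \<open>-\<pi>\<close> if it lies to the right. The real
  part of \<open>winding_number\<close> is this change divided by \<open>2\<pi>\<close>, also for paths that are not closed.\<close>

definition left_of_path :: "(real \<Rightarrow> complex) \<Rightarrow> complex \<Rightarrow> bool" where
  "left_of_path \<gamma> z \<longleftrightarrow> z \<notin> range \<gamma> \<and>
     ((\<lambda>(r, s). Re (winding_number (subpath r s \<gamma>) z)) \<longlongrightarrow> 1/2) (at_bot \<times>\<^sub>F at_top)"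

definition right_of_path :: "(real \<Rightarrow> complex) \<Rightarrow> complex \<Rightarrow> bool" where
  "right_of_path \<gamma> z \<longleftrightarrow> z \<notin> range \<gamma> \<and>
     ((\<lambda>(r, s). Re (winding_number (subpath r s \<gamma>) z)) \<longlongrightarrow> - 1/2) (at_bot \<times>\<^sub>F at_top)"

definition meijer_path ::
  "nat \<Rightarrow> nat \<Rightarrow> complex list \<Rightarrow> complex list \<Rightarrow> (real \<Rightarrow> complex) \<Rightarrow> bool" where
  "meijer_path \<mu> \<nu> as bs \<gamma> \<longleftrightarrow> imag_infinity_path \<gamma> \<and>
     (\<forall>j<\<mu>. \<forall>s. bs ! j - s \<in> \<int>\<^sub>\<le>\<^sub>0 \<longrightarrow> right_of_path \<gamma> s) \<and>
     (\<forall>j<\<nu>. \<forall>s. 1 - as ! j + s \<in> \<int>\<^sub>\<le>\<^sub>0 \<longrightarrow> left_of_path \<gamma> s)"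

text \<open>The integral over the infinite path is the limit over finite pieces, both ends going to
  infinity independently. In the convergent case the value is the same for every separating
  path, so \<open>THE\<close> refers to that common value.\<close>

definition meijer_G ::
  "nat \<Rightarrow> nat \<Rightarrow> complex list \<Rightarrow> complex list \<Rightarrow> complex \<Rightarrow> complex" where
  "meijer_G \<mu> \<nu> as bs x =
     (THE G. \<exists>\<gamma>. meijer_path \<mu> \<nu> as bs \<gamma> \<and>
        ((\<lambda>(r, s). 1 / (2 * of_real pi * \<i>)
            * contour_integral (subpath r s \<gamma>) (meijer_integrand \<mu> \<nu> as bs x))
          \<longlongrightarrow> G) (at_bot \<times>\<^sub>F at_top))"

end

theory Submission
  imports Defs
begin

text \<open>Put \<open>w = \<alpha>\<^sub>1 z / \<alpha>\<^sub>2\<close> and \<open>L = ln (\<alpha>\<^sub>1 \<bar>X\<bar>) - ln (\<alpha>\<^sub>2 \<bar>Y\<bar>)\<close>. Since \<open>X / Y\<close> is symmetric and has no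
  atoms, \<open>P (X / Y \<le> z) = 1/2 + P (L \<le> ln w) / 2\<close> for \<open>z > 0\<close>. Writing \<open>K\<^sub>m\<close> as an integral over the
  whole line and rotating coordinates factorises the Mellin transform of the variance-gamma density
  into two Gamma integrals, so the Laplace transform of \<open>L\<close> is a product of four Gamma functions.
  Levy's inversion formula for an exponentially tilted law of \<open>L\<close> turns \<open>P (L \<le> ln w)\<close> into an
  integral over a vertical line \<open>Re s = c\<close> with \<open>-1/2 < c < min m 0\<close>. Since \<open>\<Gamma>\<close> decays
  on vertical strips, the integral over any other admissible path can be moved to that line: the two
  paths, closed up by horizontal segments, form a loop whose winding number around each of the finitely
  many poles in the strip is an integer and tends to \<open>0\<close>.\<close>

section \<open>Inversion of the Laplace transform of a distribution\<close>

text \<open>In the G-function the quotient of \<open>Gamma (1/2 + s)\<close> and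
  \<open>Gamma (3/2 + s)\<close> is \<open>1 / (s + 1/2)\<close>. Up to the factor 2 this is what
  passing from a law to its distribution function does to the transform; the other four Gamma
  factors belong to the law of \<open>L\<close>. The pole at \<open>- 1/2\<close> is the reason for
  the tilt: untilted inversion would run along \<open>Re s = - 1/2\<close>, straight through it.
  Weighting the law by \<open>exp (- k * x)\<close> with \<open>k = 2 * c + 1\<close> moves the line
  to \<open>Re s = c\<close>, and \<open>c < 0\<close>, \<open>c < m\<close> keep the negative
  moment of \<open>\<bar>X\<bar>\<close> that this needs finite. A second obstacle is
  \<open>meijer_G\<close> itself: \<open>THE\<close> ranges over all separating paths, whose sides
  are known only through limits of real parts of winding numbers, so a value on one line is not
  enough and independence of the path must be proved. The behaviour of G near 0 is never analysed;
  the limit of \<open>T\<close> comes from continuity of the distribution function.\<close>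

lemma (in pair_sigma_finite) integrable_mult_fst_snd:
  fixes f :: "'a \<Rightarrow> 'c::{banach, second_countable_topology, real_normed_algebra}" and g :: "'b \<Rightarrow> 'c"
  assumes f: "integrable M1 f" and g: "integrable M2 g"
  shows "integrable (M1 \<Otimes>\<^sub>M M2) (\<lambda>(x, y). f x * g y)"
proof (rule Fubini_integrable)
  have [measurable]: "f \<in> borel_measurable M1" "g \<in> borel_measurable M2"
    using f g by auto
  show "(\<lambda>(x, y). f x * g y) \<in> borel_measurable (M1 \<Otimes>\<^sub>M M2)" by measurable
  show "AE x in M1. integrable M2 (\<lambda>y. case (x, y) of (x, y) \<Rightarrow> f x * g y)"
    using g by simp
  have "integrable M1 (\<lambda>x. norm (f x) * (\<integral>y. norm (g y) \<partial>M2))"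
    using f by (intro integrable_mult_left integrable_norm) auto
  then show "integrable M1 (\<lambda>x. \<integral>y. norm (case (x, y) of (x, y) \<Rightarrow> f x * g y) \<partial>M2)"
  proof (rule Bochner_Integration.integrable_bound)
    show "AE x in M1. norm (\<integral>y. norm (case (x, y) of (x, y) \<Rightarrow> f x * g y) \<partial>M2)
        \<le> norm (norm (f x) * (\<integral>y. norm (g y) \<partial>M2))"
    proof (rule AE_I2)
      fix x
      have "(\<integral>y. norm (f x * g y) \<partial>M2) \<le> (\<integral>y. norm (f x) * norm (g y) \<partial>M2)"
        using g by (intro integral_mono integrable_norm integrable_mult_right norm_mult_ineq) auto
      then show "norm (\<integral>y. norm (case (x, y) of (x, y) \<Rightarrow> f x * g y) \<partial>M2)
        \<le> norm (norm (f x) * (\<integral>y. norm (g y) \<partial>M2))"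
        by (simp add: integral_nonneg_AE abs_mult)
    qed
  qed measurable
qed

lemma
  fixes z :: complex
  assumes "Re z > 0"
  shows set_integrable_exp_atMost: "set_integrable lborel {..l} (\<lambda>a. exp (z * of_real a))"
    and integral_exp_atMost: "(LINT a:{..l}|lborel. exp (z * of_real a)) = exp (z * of_real l) / z"
proof -
  have lim: "((\<lambda>a. exp (w * complex_of_real a) / w) \<longlongrightarrow> 0) at_bot" if "Re w > 0" for w
  proof (rule tendsto_norm_zero_cancel)
    have "((\<lambda>a. exp (Re w * a) / cmod w) \<longlongrightarrow> 0 / cmod w) at_bot"
      using that by (intro tendsto_divide tendsto_const filterlim_compose[OF exp_at_bot]
           filterlim_tendsto_pos_mult_at_bot[OF tendsto_const] filterlim_ident) auto
    then show "((\<lambda>a. norm (exp (w * complex_of_real a) / w)) \<longlongrightarrow> 0) at_bot"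
      by (simp add: norm_divide)
  qed
  have ev: "einterval (-\<infinity>) (ereal l) = {..<l}" by (auto simp: einterval_def)
  \<comment> \<open>Integrability is first obtained for the norm of the integrand, because the
    fundamental theorem for nonnegative functions delivers it as a conclusion. The complex version
    then takes it as a premise.\<close>
  have "set_integrable lborel (einterval (-\<infinity>) (ereal l)) (\<lambda>a. exp (Re z * a))"
  proof (rule interval_integral_FTC_nonneg)
    show "((\<lambda>a. exp (Re z * a) / Re z) has_real_derivative exp (Re z * a)) (at a)" for a
      using assms by (auto intro!: derivative_eq_intros)
    show "(((\<lambda>a. exp (Re z * a) / Re z) \<circ> real_of_ereal) \<longlongrightarrow> 0) (at_right (-\<infinity>))"
    proof -
      have "((\<lambda>a. exp (Re z * a) / Re z) \<longlongrightarrow> 0 / Re z) at_bot"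
        using assms by (intro tendsto_divide tendsto_const filterlim_compose[OF exp_at_bot]
           filterlim_tendsto_pos_mult_at_bot[OF tendsto_const] filterlim_ident) auto
      then show ?thesis by (simp add: ereal_tendsto_simps)
    qed
    show "(((\<lambda>a. exp (Re z * a) / Re z) \<circ> real_of_ereal) \<longlongrightarrow> exp (Re z * l) / Re z) (at_left (ereal l))"
      using assms by (simp add: ereal_tendsto_simps) (intro tendsto_intros, auto)
  qed auto
  then have "set_integrable lborel {..<l} (\<lambda>a. exp (z * of_real a))"
    unfolding ev by (rule set_integrable_bound) (auto simp: set_borel_measurable_def)
  then have int: "set_integrable lborel (einterval (-\<infinity>) (ereal l)) (\<lambda>a. exp (z * of_real a))"
    unfolding ev .
  have "(LBINT a=-\<infinity>..ereal l. exp (z * of_real a)) = exp (z * of_real l) / z - 0"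
  proof (rule interval_integral_FTC_integrable[OF _ _ _ int])
    show "((\<lambda>a. exp (z * of_real a) / z) has_vector_derivative exp (z * of_real a)) (at a)" for a
    proof (rule has_vector_derivative_real_field)
      show "((\<lambda>w. exp (z * w) / z) has_field_derivative exp (z * of_real a)) (at (of_real a))"
        using assms by (auto intro!: derivative_eq_intros)
    qed
    show "(((\<lambda>a. exp (z * of_real a) / z) \<circ> real_of_ereal) \<longlongrightarrow> 0) (at_right (-\<infinity>))"
      using lim[OF assms] by (simp add: ereal_tendsto_simps)
    show "(((\<lambda>a. exp (z * of_real a) / z) \<circ> real_of_ereal) \<longlongrightarrow> exp (z * of_real l) / z) (at_left (ereal l))"
      using assms by (simp add: ereal_tendsto_simps) (intro tendsto_intros, auto)
  qed auto
  then have L: "(LINT a:{..<l}|lborel. exp (z * of_real a)) = exp (z * of_real l) / z"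
    by (simp add: interval_lebesgue_integral_def ev)
  have eq: "AE x in lborel. indicator {..<l} x *\<^sub>R exp (z * complex_of_real x) = indicator {..l} x *\<^sub>R exp (z * of_real x)"
    using AE_lborel_singleton[of l] by eventually_elim (auto simp: indicator_def)
  show "set_integrable lborel {..l} (\<lambda>a. exp (z * of_real a))"
    using \<open>set_integrable lborel {..<l} _\<close> unfolding set_integrable_def
    by (subst integrable_cong_AE[OF _ _ AE_symmetric[OF eq]]) auto
  show "(LINT a:{..l}|lborel. exp (z * of_real a)) = exp (z * of_real l) / z"
    using L unfolding set_lebesgue_integral_def
    by (subst integral_cong_AE[OF _ _ AE_symmetric[OF eq]]) auto
qed

text \<open>For \<open>t \<noteq> 0\<close> the quotient is the integral of
  \<open>iexp (- (t * s))\<close> over \<open>s\<close> from \<open>a\<close> to \<open>b\<close>,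
  whence a bound by the length, uniform in \<open>t\<close>. At \<open>t = 0\<close> it is
  \<open>0\<close> by the convention for division.\<close>

lemma norm_iexp_diff_quotient_le:
  assumes "a \<le> b"
  shows "cmod ((iexp (- (t * a)) - iexp (- (t * b))) / (\<i> * complex_of_real t)) \<le> b - a"
proof (cases "t = 0")
  case False
  have "cmod ((iexp (- (t * a)) - iexp (- (t * b))) / (\<i> * complex_of_real t))
      = cmod ((iexp (- t * b) - iexp (- t * a)) / (\<i> * complex_of_real (- t)))"
    by (simp add: norm_divide norm_minus_commute norm_mult)
  also have "\<dots> \<le> b - a" using False assms by (intro Levy_Inversion_aux2) auto
  finally show ?thesis .
qed (use assms in simp)

text \<open>Levy's formula gives the mass as a limit of integrals over \<open>{-T..T}\<close>. The
  kernel is bounded and \<open>char M\<close> integrable, so dominated convergence turns the limit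
  into a Lebesgue integral, to which Fubini can be applied later.\<close>

lemma (in real_distribution) measure_Ioc_eq_integral_char:
  assumes "a \<le> b" and "prob {a} = 0" "prob {b} = 0" and int: "integrable lborel (char M)"
  shows "complex_of_real (prob {a<..b})
    = 1 / (2 * pi) * (\<integral>t. (iexp (- (t * a)) - iexp (- (t * b))) / (\<i> * t) * char M t \<partial>lborel)"
proof -
  let ?g = "\<lambda>t. (iexp (- (t * a)) - iexp (- (t * b))) / (\<i> * complex_of_real t) * char M t"
  have bound: "norm (?g t) \<le> norm ((b - a) *\<^sub>R char M t)" for t
    unfolding norm_mult norm_scaleR
    by (intro mult_right_mono order_trans[OF norm_iexp_diff_quotient_le[OF assms(1)]]) auto
  have [measurable]: "char M \<in> borel_measurable borel" using int by auto
  have g: "integrable lborel ?g"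
  proof (rule Bochner_Integration.integrable_bound)
    show "integrable lborel (\<lambda>t. (b - a) *\<^sub>R char M t)" using int by simp
    show "AE t in lborel. norm (?g t) \<le> norm ((b - a) *\<^sub>R char M t)" using bound by simp
  qed measurable
  have "(\<lambda>T. CLBINT t=-real T..real T. ?g t) \<longlonglongrightarrow> (\<integral>t. ?g t \<partial>lborel)"
  proof -
    have "(\<lambda>T. LINT t|lborel. indicator {-real T..real T} t *\<^sub>R ?g t) \<longlonglongrightarrow> (\<integral>t. ?g t \<partial>lborel)"
    proof (rule integral_dominated_convergence)
      show "integrable lborel (\<lambda>t. norm (?g t))" using g by (rule integrable_norm)
      show "AE t in lborel. (\<lambda>T. indicator {-real T..real T} t *\<^sub>R ?g t) \<longlonglongrightarrow> ?g t"
      proof (rule AE_I2)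
        fix t :: real
        obtain N :: nat where "\<bar>t\<bar> \<le> real N" using real_arch_simple by blast
        then have "\<forall>T\<ge>N. indicator {-real T..real T} t *\<^sub>R ?g t = ?g t"
          by (auto simp: indicator_def)
        then show "(\<lambda>T. indicator {-real T..real T} t *\<^sub>R ?g t) \<longlonglongrightarrow> ?g t"
          by (intro tendsto_eventually) (auto simp: eventually_sequentially)
      qed
    qed (use g in \<open>auto simp: indicator_def\<close>)
    moreover have "(CLBINT t=-real T..real T. ?g t) = (LINT t|lborel. indicator {-real T..real T} t *\<^sub>R ?g t)" for T
      using interval_integral_Icc[of "-real T" "real T" ?g] by (simp add: set_lebesgue_integral_def)
    ultimately show ?thesis by (simp only:)
  qed
  then have "(\<lambda>T. 1 / (2 * pi) * (CLBINT t=-real T..real T. ?g t)) \<longlonglongrightarrow> 1 / (2 * pi) * (\<integral>t. ?g t \<partial>lborel)"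
    by (intro tendsto_mult tendsto_const)
  moreover have "(\<lambda>T. 1 / (2 * pi) * (CLBINT t=-real T..real T. ?g t)) \<longlonglongrightarrow> complex_of_real (prob {a<..b})"
    using Levy_Inversion[OF assms(1-3)] by simp
  ultimately show ?thesis by (metis (no_types, lifting) LIMSEQ_unique)
qed

text \<open>The condition \<open>x \<le> l\<close> does not involve \<open>a\<close>: for
  \<open>x > l\<close> the set is empty, otherwise it is \<open>{..<x}\<close>. In this form the
  weight \<open>exp (k * x)\<close>, which undoes the tilt, is a mixture of indicators of the
  intervals \<open>{a<..l}\<close>, whose masses Levy's formula computes.\<close>

lemma LBINT_exp_less:
  fixes x l k :: real
  assumes "k > 0"
  shows "(\<integral>a. indicator {a. a < x \<and> x \<le> l} a *\<^sub>R (k * exp (k * a)) \<partial>lborel) = indicator {..l} x * exp (k * x)"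
    and "integrable lborel (\<lambda>a. indicator {a. a < x \<and> x \<le> l} a *\<^sub>R (k * exp (k * a)))"
proof -
  have R: "Re (complex_of_real k) > 0" using assms by simp
  have e: "exp (complex_of_real k * of_real a) = of_real (exp (k * a))" for a
    by (simp flip: exp_of_real)
  have int: "set_integrable lborel {..x} (\<lambda>a. exp (k * a))"
    using set_integrable_exp_atMost[OF R, of x] unfolding e set_integrable_def
    using complex_of_real_integrable_eq[of lborel "\<lambda>a. indicator {..x} a * exp (k * a)"]
    by (simp add: scaleR_conv_of_real)
  have "complex_of_real (LBINT a:{..x}. exp (k * a)) = of_real (exp (k * x) / k)"
    using integral_exp_atMost[OF R, of x] unfolding e set_lebesgue_integral_def
    by (simp add: scaleR_conv_of_real e flip: of_real_mult)
  then have val: "(LBINT a:{..x}. exp (k * a)) = exp (k * x) / k"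
    by (simp only: of_real_eq_iff)
  have ae: "AE a in lborel. indicator {a. a < x \<and> x \<le> l} a *\<^sub>R (k * exp (k * a))
      = (indicator {..l} x * k) * (indicator {..x} a *\<^sub>R exp (k * a))"
    using AE_lborel_singleton[of x] by eventually_elim (auto simp: indicator_def)
  show "(\<integral>a. indicator {a. a < x \<and> x \<le> l} a *\<^sub>R (k * exp (k * a)) \<partial>lborel) = indicator {..l} x * exp (k * x)"
    using val assms by (subst integral_cong_AE[OF _ _ ae]) (auto simp: set_lebesgue_integral_def)
  show "integrable lborel (\<lambda>a. indicator {a. a < x \<and> x \<le> l} a *\<^sub>R (k * exp (k * a)))"
    using int by (subst integrable_cong_AE[OF _ _ ae]) (auto simp: set_integrable_def)
qed

text \<open>This averages the Levy kernels of the intervals \<open>{a<..l}\<close> over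
  \<open>a\<close>. Each kernel is a difference of two exponentials, integrated separately;
  afterwards the singular factor \<open>1 / t\<close> cancels. At \<open>t = 0\<close> the left side
  is \<open>0\<close> by convention and the right side is not.\<close>

lemma
  fixes k l t :: real
  assumes "k > 0"
  shows LBINT_tilted_Levy_kernel: "t \<noteq> 0 \<Longrightarrow> (LINT a:{..l}|lborel. of_real (k * exp (k * a)) * ((iexp (- (t * a)) - iexp (- (t * l))) / (\<i> * complex_of_real t)))
     = exp ((of_real k - \<i> * of_real t) * of_real l) / (of_real k - \<i> * of_real t)"
proof -
  assume t: "t \<noteq> 0"
  define z where "z = of_real k - \<i> * complex_of_real t"
  have Re: "Re z > 0" "Re (complex_of_real k) > 0" using assms by (simp_all add: z_def)
  then have z0: "z \<noteq> 0" by auto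
  have e: "iexp (- (t * l)) = exp (z * of_real l) / exp (of_real k * of_real l)"
    by (simp add: z_def algebra_simps flip: exp_diff)
  have eq: "of_real (k * exp (k * a)) * ((iexp (- (t * a)) - iexp (- (t * l))) / (\<i> * complex_of_real t))
     = k / (\<i> * t) * exp (z * of_real a) - k * iexp (- (t * l)) / (\<i> * t) * exp (of_real k * of_real a)" for a
    using t by (simp add: z_def field_simps exp_diff exp_minus exp_add flip: exp_of_real)
  have "(LINT a:{..l}|lborel. of_real (k * exp (k * a)) * ((iexp (- (t * a)) - iexp (- (t * l))) / (\<i> * complex_of_real t)))
     = k / (\<i> * t) * (exp (z * of_real l) / z) - k * iexp (- (t * l)) / (\<i> * t) * (exp (of_real k * of_real l) / of_real k)"
    unfolding eq using set_integrable_exp_atMost[OF Re(1), of l] set_integrable_exp_atMost[OF Re(2), of l]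
      integral_exp_atMost[OF Re(1), of l] integral_exp_atMost[OF Re(2), of l]
    by (subst set_integral_diff) auto
  also have "\<dots> = k / (\<i> * t) * (exp (z * of_real l) / z) - k * (exp (z * of_real l) / exp (of_real k * of_real l)) / (\<i> * t) * (exp (of_real k * of_real l) / of_real k)"
    unfolding e ..
  also have "\<dots> = exp (z * of_real l) * ((of_real k - z) / (\<i> * t)) / z"
    using assms z0 t by (simp add: divide_simps) (simp add: algebra_simps)
  also have "(of_real k - z) / (\<i> * t) = 1" using t by (simp add: z_def)
  finally show ?thesis unfolding z_def[symmetric] by (simp only: mult_1_right)
qed

text \<open>The factor \<open>l - a\<close> is the uniform bound on the Levy kernel of
  \<open>{a<..l}\<close>, so this function dominates in \<open>a\<close> when the integrals over
  \<open>a\<close> and \<open>t\<close> are exchanged.\<close>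

lemma integrable_tilt_weight:
  fixes k l :: real
  assumes "k > 0"
  shows "set_integrable lborel {..l} (\<lambda>a. k * exp (k * a) * (l - a))"
proof (rule set_integrable_bound)
  have R: "Re (complex_of_real (k / 2)) > 0" using assms by simp
  have "exp (complex_of_real (k / 2) * of_real a) = of_real (exp (k / 2 * a))" for a
    by (simp flip: exp_of_real)
  then have "set_integrable lborel {..l} (\<lambda>a. exp (k / 2 * a))"
    using set_integrable_exp_atMost[OF R, of l]
      complex_of_real_integrable_eq[of lborel "\<lambda>a. indicator {..l} a * exp (k / 2 * a)"]
    unfolding set_integrable_def by (simp add: scaleR_conv_of_real)
  then show "set_integrable lborel {..l} (\<lambda>a. 2 * exp (k / 2 * l) * exp (k / 2 * a))"
    by (rule set_integrable_mult_right)
  show "set_borel_measurable lborel {..l} (\<lambda>a. k * exp (k * a) * (l - a))"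
    by (simp add: set_borel_measurable_def)
  show "AE a in lborel. a \<in> {..l} \<longrightarrow> norm (k * exp (k * a) * (l - a)) \<le> norm (2 * exp (k / 2 * l) * exp (k / 2 * a))"
  proof (intro AE_I2 impI)
    fix a assume a: "a \<in> {..l}"
    \<comment> \<open>Half of the exponential decay is spent on absorbing the linear factor;
      \<open>exp (k / 2 * a)\<close> remains.\<close>
    have "1 + k * (l - a) / 2 \<le> exp (k * (l - a) / 2)" by (rule exp_ge_add_one_self)
    then have "k * (l - a) \<le> 2 * exp (k * (l - a) / 2)" by linarith
    then have "exp (k * a) * (k * (l - a)) \<le> exp (k * a) * (2 * exp (k * (l - a) / 2))"
      by (intro mult_left_mono) auto
    also have "\<dots> = 2 * exp (k / 2 * l) * exp (k / 2 * a)"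
      by (simp add: field_simps flip: exp_add)
    finally show "norm (k * exp (k * a) * (l - a)) \<le> norm (2 * exp (k / 2 * l) * exp (k / 2 * a))"
      using a assms by (simp add: abs_mult mult_ac)
  qed
qed

text \<open>Up to normalisation, \<open>\<Phi>\<close> is the characteristic function of the law
  weighted by \<open>exp (- k * x)\<close>. Averaging Levy's formula over the left endpoints with
  weight \<open>k * exp (k * a)\<close> does two things at once: it removes the tilt, and it
  replaces the singular \<open>1 / (\<i> * t)\<close> by \<open>1 / (k - \<i> * t)\<close>, which is
  bounded because \<open>k > 0\<close>.\<close>

theorem (in real_distribution) prob_atMost_eq_inversion_integral:
  fixes k l :: real
  defines "\<Phi> \<equiv> \<lambda>t. \<integral>x. exp ((\<i> * of_real t - of_real k) * complex_of_real x) \<partial>M"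
  assumes k: "k > 0" and atomless: "\<And>a. prob {a} = 0"
    and moment: "integrable M (\<lambda>x. exp (- k * x))" and int: "integrable lborel \<Phi>"
  shows "complex_of_real (prob {..l})
    = 1 / (2 * pi) * (\<integral>t. \<Phi> t * (exp ((of_real k - \<i> * of_real t) * of_real l) / (of_real k - \<i> * of_real t)) \<partial>lborel)"
proof -
  define C where "C = (\<integral>x. exp (- k * x) \<partial>M)"
  have C: "C > 0"
  proof -
    have "C \<noteq> 0"
    proof
      assume "C = 0"
      then have "AE x in M. exp (- k * x) = 0"
        unfolding C_def using moment by (subst (asm) integral_nonneg_eq_0_iff_AE) auto
      then show False by simp
    qed
    moreover have "C \<ge> 0" unfolding C_def by (intro integral_nonneg_AE) auto
    ultimately show ?thesis by simp
  qed
  define N where "N = density M (\<lambda>x. ennreal (exp (- k * x) / C))"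
  have "emeasure N (space N) = (\<integral>\<^sup>+ x. ennreal (exp (- k * x) / C) \<partial>M)"
    by (simp add: N_def emeasure_density cong: nn_integral_cong)
  also have "\<dots> = ennreal (\<integral>x. exp (- k * x) / C \<partial>M)"
    using moment C by (intro nn_integral_eq_integral) auto
  also have "\<dots> = 1" using C by (simp add: C_def)
  finally have "emeasure N (space N) = 1" .
  then interpret N: real_distribution N
    unfolding real_distribution_def real_distribution_axioms_def by (auto simp: N_def intro!: prob_spaceI)
  have charN: "char N t = \<Phi> t / C" for t
    unfolding char_def N_def \<Phi>_def
    using C by (subst integral_density)
      (auto simp: scaleR_conv_of_real algebra_simps exp_diff exp_minus field_simps
         intro!: Bochner_Integration.integral_cong simp flip: exp_of_real integral_divide_zero)
  have charNint: "integrable lborel (char N)"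
    unfolding charN[abs_def] using int by simp
  have measN: "N.prob A = (\<integral>x. indicator A x * exp (- k * x) \<partial>M) / C" if "A \<in> sets borel" for A
  proof -
    have "N.prob A = (\<integral>x. indicator A x \<partial>N)" using that by simp
    also have "\<dots> = (\<integral>x. (exp (- k * x) / C) *\<^sub>R indicator A x \<partial>M)"
      unfolding N_def using that C by (subst integral_density) auto
    also have "\<dots> = (\<integral>x. indicator A x * exp (- k * x) / C \<partial>M)" by (simp add: mult.commute)
    finally show ?thesis by simp
  qed
  have atomlessN: "N.prob {a} = 0" for a
  proof -
    have "AE x in M. x \<notin> {a}" using atomless[of a] by (subst (asm) prob_eq_0) auto
    then have "(\<integral>x. indicator {a} x * exp (- k * x) \<partial>M) = 0"
      by (intro integral_eq_zero_AE) (auto elim!: eventually_mono)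
    then show ?thesis by (simp add: measN)
  qed
  interpret P: pair_sigma_finite M "lborel :: real measure" ..
  \<comment> \<open>Since \<open>exp (k x) 1{x \<le> l}\<close> is the integral of \<open>k exp (k a) 1{a < x \<le> l}\<close> over \<open>a\<close>, the tilted
    masses of the intervals \<open>{a<..l}\<close> determine the untilted distribution function.\<close>
  let ?f = "\<lambda>x a. exp (- k * x) * (indicator {a. a < x \<and> x \<le> l} a *\<^sub>R (k * exp (k * a)))"
  have inner: "(\<integral>a. ?f x a \<partial>lborel) = indicator {..l} x" for x
    using LBINT_exp_less(1)[OF k, of x l] LBINT_exp_less(2)[OF k, of x l]
    by (simp add: indicator_def flip: exp_add)
  have fint: "integrable (M \<Otimes>\<^sub>M lborel) (\<lambda>(x, a). ?f x a)"
  proof (rule P.Fubini_integrable)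
    show "(\<lambda>(x, a). ?f x a) \<in> borel_measurable (M \<Otimes>\<^sub>M lborel)" by (auto simp: indicator_def) measurable
    have "norm (?f x a) = ?f x a" for x a using k by (simp add: indicator_def)
    moreover have "integrable M (indicator {..l} :: real \<Rightarrow> real)"
      by (rule integrable_real_indicator) (auto simp: less_top[symmetric])
    ultimately show "integrable M (\<lambda>x. \<integral>a. norm (case (x, a) of (x, a) \<Rightarrow> ?f x a) \<partial>lborel)"
      using inner by simp
    show "AE x in M. integrable lborel (\<lambda>a. case (x, a) of (x, a) \<Rightarrow> ?f x a)"
      using LBINT_exp_less(2)[OF k, of _ l] by auto
  qed
  have "prob {..l} = (\<integral>x. indicator {..l} x \<partial>M)" by simp
  also have "\<dots> = (\<integral>x. (\<integral>a. ?f x a \<partial>lborel) \<partial>M)" unfolding inner ..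
  also have "\<dots> = (\<integral>a. (\<integral>x. ?f x a \<partial>M) \<partial>lborel)"
    using P.Fubini_integral[of ?f] fint by simp
  also have "\<dots> = (LBINT a:{..l}. k * exp (k * a) * (C * N.prob {a<..l}))"
    unfolding set_lebesgue_integral_def
  proof (rule Bochner_Integration.integral_cong[OF refl])
    fix a
    have "(\<integral>x. ?f x a \<partial>M) = (\<integral>x. k * exp (k * a) * (indicator {a<..l} x * exp (- k * x)) \<partial>M)"
      by (intro Bochner_Integration.integral_cong) (auto simp: indicator_def)
    also have "\<dots> = k * exp (k * a) * (C * N.prob {a<..l})"
      using C by (simp add: measN)
    finally show "(\<integral>x. ?f x a \<partial>M) = indicator {..l} a *\<^sub>R (k * exp (k * a) * (C * N.prob {a<..l}))"
      by (auto simp: indicator_def)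
  qed
  finally have 1: "complex_of_real (prob {..l}) = (LINT a:{..l}|lborel. complex_of_real (k * exp (k * a) * (C * N.prob {a<..l})))"
    unfolding set_lebesgue_integral_def by (simp add: scaleR_conv_of_real flip: of_real_mult)
  let ?D = "\<lambda>a t. (iexp (- (t * a)) - iexp (- (t * l))) / (\<i> * complex_of_real t)"
  let ?h = "\<lambda>a t. indicator {..l} a *\<^sub>R (complex_of_real (k * exp (k * a)) * ?D a t * \<Phi> t)"
  have [measurable]: "\<Phi> \<in> borel_measurable borel" using int by auto
  \<comment> \<open>The kernel is bounded by \<open>l - a\<close> uniformly in \<open>t\<close>, so
    \<open>?h\<close> is dominated by a product of an integrable function of \<open>a\<close> and
    one of \<open>t\<close>.\<close>
  have hint: "integrable (lborel \<Otimes>\<^sub>M lborel) (\<lambda>(a, t). ?h a t)"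
  proof (rule Bochner_Integration.integrable_bound)
    show "integrable (lborel \<Otimes>\<^sub>M lborel) (\<lambda>(a, t). (indicator {..l} a *\<^sub>R (k * exp (k * a) * (l - a))) * norm (\<Phi> t))"
      using integrable_tilt_weight[OF k, of l] int unfolding set_integrable_def
      by (intro lborel_pair.integrable_mult_fst_snd) auto
    have "norm (?h a t) \<le> (indicator {..l} a *\<^sub>R (k * exp (k * a) * (l - a))) * norm (\<Phi> t)" for a t
    proof (cases "a \<le> l")
      case True
      have "norm (?h a t) = k * exp (k * a) * norm (?D a t) * norm (\<Phi> t)"
        using True k by (simp only: norm_mult norm_scaleR norm_of_real) (simp add: abs_mult)
      also have "\<dots> \<le> k * exp (k * a) * (l - a) * norm (\<Phi> t)"
        using k by (intro mult_right_mono mult_left_mono norm_iexp_diff_quotient_le True) auto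
      finally show ?thesis using True by simp
    qed simp
    then have "norm (?h a t) \<le> norm ((indicator {..l} a *\<^sub>R (k * exp (k * a) * (l - a))) * norm (\<Phi> t))" for a t
      unfolding real_norm_def by (rule order_trans[OF _ abs_ge_self])
    then show "AE x in lborel \<Otimes>\<^sub>M lborel. norm (case x of (a, t) \<Rightarrow> ?h a t)
        \<le> norm (case x of (a, t) \<Rightarrow> (indicator {..l} a *\<^sub>R (k * exp (k * a) * (l - a))) * norm (\<Phi> t))"
      by (intro AE_I2) (simp only: case_prod_beta)
  qed measurable
  have "(LINT a:{..l}|lborel. complex_of_real (k * exp (k * a) * (C * N.prob {a<..l})))
     = (\<integral>a. 1 / (2 * pi) * (\<integral>t. ?h a t \<partial>lborel) \<partial>lborel)"
    unfolding set_lebesgue_integral_def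
  proof (rule Bochner_Integration.integral_cong[OF refl])
    fix a
    show "indicator {..l} a *\<^sub>R complex_of_real (k * exp (k * a) * (C * N.prob {a<..l})) = 1 / (2 * pi) * (\<integral>t. ?h a t \<partial>lborel)"
    proof (cases "a \<le> l")
      case True
      have "complex_of_real (N.prob {a<..l}) = 1 / (2 * pi) * (\<integral>t. ?D a t * (\<Phi> t / C) \<partial>lborel)"
        using N.measure_Ioc_eq_integral_char[OF True atomlessN atomlessN charNint] by (simp only: charN)
      also have "\<dots> = 1 / (2 * pi) * ((\<integral>t. ?D a t * \<Phi> t \<partial>lborel) / C)"
        by (simp only: times_divide_eq_right integral_divide_zero)
      finally have p: "complex_of_real (C * N.prob {a<..l}) = 1 / (2 * pi) * (\<integral>t. ?D a t * \<Phi> t \<partial>lborel)"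
        using C by simp
      have "indicator {..l} a *\<^sub>R complex_of_real (k * exp (k * a) * (C * N.prob {a<..l}))
          = complex_of_real (k * exp (k * a)) * complex_of_real (C * N.prob {a<..l})"
        using True by simp
      also have "\<dots> = 1 / (2 * pi) * (complex_of_real (k * exp (k * a)) * (\<integral>t. ?D a t * \<Phi> t \<partial>lborel))"
        unfolding p by (simp only: mult.left_commute)
      also have "complex_of_real (k * exp (k * a)) * (\<integral>t. ?D a t * \<Phi> t \<partial>lborel) = (\<integral>t. complex_of_real (k * exp (k * a)) * (?D a t * \<Phi> t) \<partial>lborel)"
        by (simp only: integral_mult_right_zero)
      also have "\<dots> = (\<integral>t. ?h a t \<partial>lborel)"
        using True by (simp add: mult.assoc)
      finally show ?thesis .
    qed simp
  qed
  also have "\<dots> = 1 / (2 * pi) * (\<integral>a. (\<integral>t. ?h a t \<partial>lborel) \<partial>lborel)"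
    by (rule integral_mult_right_zero)
  also have "(\<integral>a. (\<integral>t. ?h a t \<partial>lborel) \<partial>lborel) = (\<integral>t. (\<integral>a. ?h a t \<partial>lborel) \<partial>lborel)"
    using lborel_pair.Fubini_integral[of ?h] hint by simp
  also have "\<dots> = (\<integral>t. \<Phi> t * (exp ((of_real k - \<i> * of_real t) * of_real l) / (of_real k - \<i> * of_real t)) \<partial>lborel)"
  proof (rule integral_cong_AE)
    \<comment> \<open>The kernel has the default value \<open>0\<close> at \<open>t = 0\<close>, so
      the two sides agree only off this null set.\<close>
    show "AE t in lborel. (\<integral>a. ?h a t \<partial>lborel) = \<Phi> t * (exp ((of_real k - \<i> * of_real t) * of_real l) / (of_real k - \<i> * of_real t))"
      using AE_lborel_singleton[of 0]
    proof eventually_elim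
      case (elim t)
      have "(\<integral>a. ?h a t \<partial>lborel) = (\<integral>a. \<Phi> t * (indicator {..l} a *\<^sub>R (complex_of_real (k * exp (k * a)) * ?D a t)) \<partial>lborel)"
        by (intro Bochner_Integration.integral_cong) (auto simp: indicator_def)
      also have "\<dots> = \<Phi> t * (LINT a:{..l}|lborel. complex_of_real (k * exp (k * a)) * ?D a t)"
        unfolding set_lebesgue_integral_def by (simp only: integral_mult_right_zero)
      finally show ?case using LBINT_tilted_Levy_kernel[OF k elim, of l] by (simp only:)
    qed
  qed measurable
  finally show ?thesis unfolding 1 .
qed

section \<open>Gamma integrals and bounds\<close>

text \<open>The substitution \<open>x = c * exp y\<close> turns Mellin integrals into two-sided
  Laplace integrals. The change of variables is available for
  \<open>absolutely_integrable_on\<close>, that is, for the completed measure; Borel measurability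
  of \<open>f\<close> carries the result over to \<open>lborel\<close>.\<close>

lemma
  fixes f :: "real \<Rightarrow> 'a::euclidean_space"
  assumes "c > 0" and f[measurable]: "f \<in> borel_measurable borel"
  shows set_integrable_exp_substitution_iff:
      "set_integrable lborel {0<..} f \<longleftrightarrow> integrable lborel (\<lambda>y. (c * exp y) *\<^sub>R f (c * exp y))" (is ?A)
    and LBINT_exp_substitution:
      "integrable lborel (\<lambda>y. (c * exp y) *\<^sub>R f (c * exp y)) \<Longrightarrow>
         (LINT x:{0<..}|lborel. f x) = (\<integral>y. (c * exp y) *\<^sub>R f (c * exp y) \<partial>lborel)" (is "_ \<Longrightarrow> ?B")
proof -
  have "x \<in> range (\<lambda>y. c * exp y)" if "x > 0" for x
    using that \<open>c > 0\<close> by (intro image_eqI[of _ _ "ln (x / c)"]) auto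
  then have img: "range (\<lambda>y. c * exp y) = {0<..}"
    using \<open>c > 0\<close> by auto
  have inj: "inj (\<lambda>y. c * exp y)" using \<open>c > 0\<close> by (auto simp: inj_def)
  have der: "((\<lambda>y. c * exp y) has_field_derivative c * exp y) (at y)" for y
    by (auto intro!: derivative_eq_intros)
  have abs: "\<bar>c * exp y\<bar> = c * exp y" for y using \<open>c > 0\<close> by simp
  note cv = has_absolute_integral_change_of_variables_real[of UNIV "\<lambda>y. c * exp y" "\<lambda>y. c * exp y" f,
      unfolded img abs, OF _ der inj, simplified]
  have ac: "f absolutely_integrable_on {0<..} \<longleftrightarrow> set_integrable lborel {0<..} f"
    unfolding set_integrable_def by (rule integrable_completion) measurable
  have bc: "(\<lambda>y. (c * exp y) *\<^sub>R f (c * exp y)) absolutely_integrable_on UNIV \<longleftrightarrow>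
     integrable lborel (\<lambda>y. (c * exp y) *\<^sub>R f (c * exp y))"
    unfolding set_integrable_def by (subst integrable_completion) auto
  show ?A
    using cv ac bc by blast
  show ?B if "integrable lborel (\<lambda>y. (c * exp y) *\<^sub>R f (c * exp y))"
  proof -
    have a: "f absolutely_integrable_on {0<..}" using \<open>?A\<close> ac that by blast
    have "(LINT x:{0<..}|lborel. f x) = (LINT x:{0<..}|lebesgue. f x)"
      unfolding set_lebesgue_integral_def by (rule integral_completion[symmetric]) measurable
    also have "\<dots> = integral {0<..} f"
      by (rule set_lebesgue_integral_eq_integral(2)[OF a])
    also have "\<dots> = integral UNIV (\<lambda>y. (c * exp y) *\<^sub>R f (c * exp y))"
      using cv a by blast
    also have "\<dots> = (\<integral>y. (c * exp y) *\<^sub>R f (c * exp y) \<partial>lborel)"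
      by (rule integral_lborel[OF that])
    finally show ?thesis .
  qed
qed

text \<open>This is Euler's integral after \<open>x = exp p\<close>, followed by a shift of
  \<open>p\<close> by \<open>ln c\<close>, which produces the power \<open>c\<close> to the
  \<open>a\<close>. The scale will be \<open>c = 2\<close>, coming from the half in
  \<open>cosh\<close>.\<close>

lemma
  fixes a :: complex
  assumes "Re a > 0" and "c > 0"
  shows has_bochner_integral_Gamma_exp:
    "has_bochner_integral lborel (\<lambda>p. exp (a * of_real p - of_real (exp p / c))) (exp (a * of_real (ln c)) * Gamma a)"
proof -
  define f where "f = (\<lambda>t. complex_of_real t powr (a - 1) / of_real (exp t))"
  have [measurable]: "f \<in> borel_measurable borel" unfolding f_def by measurable
  have eq: "(1 * exp y) *\<^sub>R f (1 * exp y) = exp (a * of_real y - of_real (exp y))" for y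
  proof -
    have "of_real (exp y) powr (a - 1) = exp ((a - 1) * of_real y)"
      by (simp add: powr_def Ln_of_real)
    then show ?thesis
      by (simp add: f_def scaleR_conv_of_real exp_diff exp_of_real algebra_simps)
  qed
  have ac: "f absolutely_integrable_on {0<..} \<longleftrightarrow> set_integrable lborel {0<..} f"
    unfolding set_integrable_def by (rule integrable_completion) measurable
  have a: "f absolutely_integrable_on {0<..}"
    using absolutely_integrable_Gamma_integral'[OF assms(1)] by (simp add: f_def)
  have "(LINT x:{0<..}|lborel. f x) = (LINT x:{0<..}|lebesgue. f x)"
    unfolding set_lebesgue_integral_def by (rule integral_completion[symmetric]) measurable
  also have "\<dots> = integral {0<..} f"
    by (rule set_lebesgue_integral_eq_integral(2)[OF a])
  also have "\<dots> = Gamma a"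
    unfolding f_def by (rule integral_unique[OF Gamma_integral_complex'[OF assms(1)]])
  finally have *: "has_bochner_integral lborel (\<lambda>y. exp (a * of_real y - of_real (exp y))) (Gamma a)"
    using set_integrable_exp_substitution_iff[of 1 f] LBINT_exp_substitution[of 1 f] a ac
    unfolding eq by (simp add: has_bochner_integral_iff)
  have "has_bochner_integral lborel (\<lambda>p. exp (a * of_real (- ln c + 1 * p) - of_real (exp (- ln c + 1 * p)))) (Gamma a /\<^sub>R \<bar>1\<bar>)"
    using * by (subst (asm) lborel_has_bochner_integral_real_affine_iff[where c=1 and t="- ln c"]) auto
  then have "has_bochner_integral lborel (\<lambda>p. exp (a * of_real (ln c)) * exp (a * of_real (- ln c + 1 * p) - of_real (exp (- ln c + 1 * p)))) (exp (a * of_real (ln c)) * Gamma a)"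
    by (intro has_bochner_integral_mult_right) simp
  moreover have "exp (a * of_real (ln c)) * exp (a * of_real (- ln c + 1 * p) - of_real (exp (- ln c + 1 * p)))
     = exp (a * of_real p - of_real (exp p / c))" for p
  proof -
    have "exp (- ln c + 1 * p) = exp p / c"
      using assms(2) by (simp add: exp_diff)
    then show ?thesis by (simp add: algebra_simps flip: exp_add)
  qed
  ultimately show ?thesis by simp
qed

section \<open>Decay of \<open>Gamma\<close> on vertical strips\<close>

lemma norm_Gamma_le_Gamma_Re:
  assumes "Re z > 0"
  shows "norm (Gamma z) \<le> Gamma (Re z)"
proof -
  let ?f = "\<lambda>t. complex_of_real t powr (z - 1) / of_real (exp t)"
  have "norm (integral {0..} ?f) \<le> integral {0..} (\<lambda>t. t powr (Re z - 1) / exp t)"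
  proof (rule integral_norm_bound_integral)
    show "?f integrable_on {0..}" using Gamma_integral_complex[OF assms] by blast
    show "(\<lambda>t. t powr (Re z - 1) / exp t) integrable_on {0..}"
      using Gamma_integral_real[OF assms] by blast
    show "norm (?f t) \<le> t powr (Re z - 1) / exp t" if "t \<in> {0..}" for t
      using that by (cases "t = 0") (simp_all add: norm_divide norm_powr_real_powr)
  qed
  then show ?thesis
    using integral_unique[OF Gamma_integral_complex[OF assms]] integral_unique[OF Gamma_integral_real[OF assms]]
    by simp
qed

text \<open>The functional equation shifts \<open>z\<close> to the right by \<open>k\<close> steps.
  There \<open>norm (Gamma (z + k))\<close> is bounded by the real Gamma function on a compact
  interval, while each of the \<open>k\<close> factors of \<open>pochhammer z k\<close> has norm at
  least \<open>\<bar>Im z\<bar>\<close>. Quadratic decay suffices for everything that follows, so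
  Stirling's formula can be avoided.\<close>

lemma Gamma_strip_bound:
  obtains C where "C > 0" "\<And>z. \<bar>Re z\<bar> \<le> B \<Longrightarrow> \<bar>Im z\<bar> \<ge> 1 \<Longrightarrow> norm (Gamma z) \<le> C / \<bar>Im z\<bar> ^ 2"
proof -
  \<comment> \<open>At least two factors are needed for the square; the remaining ones push the real
    part of \<open>z + k\<close> beyond 1.\<close>
  define k :: nat where "k = 2 + nat \<lceil>\<bar>B\<bar>\<rceil>"
  have k: "real k \<ge> \<bar>B\<bar> + 2" by (simp add: k_def)
  have "continuous_on {1..real k + \<bar>B\<bar>} (Gamma :: real \<Rightarrow> real)"
    by (intro continuous_on_Gamma continuous_on_id) (auto elim!: nonpos_Ints_cases)
  then have "bounded (Gamma ` {1..real k + \<bar>B\<bar>} :: real set)"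
    using compact_continuous_image compact_imp_bounded compact_Icc by blast
  then obtain C where C: "C > 0" "\<And>x. x \<in> {1..real k + \<bar>B\<bar>} \<Longrightarrow> norm (Gamma x) \<le> C"
    unfolding bounded_pos by auto
  have "norm (Gamma z) \<le> C / \<bar>Im z\<bar> ^ 2" if z: "\<bar>Re z\<bar> \<le> B" "\<bar>Im z\<bar> \<ge> 1" for z
  proof -
    have nz: "z \<notin> \<int>\<^sub>\<le>\<^sub>0" "z + of_nat k \<notin> \<int>\<^sub>\<le>\<^sub>0"
      using z by (auto elim!: nonpos_Ints_cases simp: complex_eq_iff)
    have poch: "\<bar>Im z\<bar> ^ j \<le> norm (pochhammer z j)" for j
    proof (induction j)
      case (Suc j)
      have "\<bar>Im z\<bar> \<le> norm (z + of_nat j)"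
        using abs_Im_le_cmod[of "z + of_nat j"] by simp
      from mult_mono[OF Suc.IH this] show ?case by (simp add: pochhammer_Suc norm_mult mult.commute)
    qed simp
    have p0: "pochhammer z k \<noteq> 0"
    proof
      assume "pochhammer z k = 0"
      then have "\<bar>Im z\<bar> ^ k \<le> 0" using poch[of k] by simp
      with one_le_power[OF z(2), of k] show False by linarith
    qed
    have "norm (Gamma (z + of_nat k)) \<le> Gamma (Re z + real k)"
    proof -
      have "norm (Gamma (z + of_nat k)) \<le> Gamma (Re (z + of_nat k))"
      proof (rule norm_Gamma_le_Gamma_Re)
        show "0 < Re (z + of_nat k)" using z k by simp
      qed
      then show ?thesis by simp
    qed
    also have "\<dots> \<le> C"
    proof -
      have "1 \<le> Re z + real k" "Re z + real k \<le> real k + \<bar>B\<bar>" using z k by linarith+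
      with C(2)[of "Re z + real k"] show ?thesis by simp
    qed
    finally have G: "norm (Gamma (z + of_nat k)) \<le> C" .
    have "Gamma z = Gamma (z + of_nat k) / pochhammer z k"
    proof -
      have "Gamma z \<noteq> 0" "Gamma (z + of_nat k) \<noteq> 0" using nz by (simp_all add: Gamma_eq_zero_iff)
      then show ?thesis unfolding pochhammer_Gamma[OF nz(1), of k] by simp
    qed
    then have "norm (Gamma z) = norm (Gamma (z + of_nat k)) / norm (pochhammer z k)"
      by (simp add: norm_divide)
    also have "\<dots> \<le> C / \<bar>Im z\<bar> ^ 2"
    proof (rule frac_le)
      have "\<bar>Im z\<bar> ^ 2 \<le> \<bar>Im z\<bar> ^ k" using z by (intro power_increasing) (auto simp: k_def)
      with poch[of k] show "\<bar>Im z\<bar> ^ 2 \<le> norm (pochhammer z k)" by linarith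
    qed (use C G z in auto)
    finally show ?thesis .
  qed
  with C(1) show ?thesis using that by blast
qed

lemma integrable_if_bound_inverse_square:
  fixes f :: "real \<Rightarrow> 'a::{banach, second_countable_topology}"
  assumes cont: "continuous_on UNIV f" and bd: "\<And>t. \<bar>t\<bar> \<ge> 1 \<Longrightarrow> norm (f t) \<le> C / t\<^sup>2"
  shows "integrable lborel f"
proof -
  have "bounded (f ` {-1..1})"
    by (intro compact_imp_bounded compact_continuous_image continuous_on_subset[OF cont]) auto
  then obtain D where D: "D > 0" "\<And>t. t \<in> {-1..1} \<Longrightarrow> norm (f t) \<le> D"
    unfolding bounded_pos by auto
  have bound: "norm (f t) \<le> 2 * (\<bar>C\<bar> + D) * inverse (1 + t\<^sup>2)" for t
  proof (cases "\<bar>t\<bar> \<ge> 1")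
    case True
    then have t: "t\<^sup>2 \<ge> 1" using one_le_power[of "\<bar>t\<bar>" 2] by simp
    have "norm (f t) \<le> C / t\<^sup>2" by (rule bd[OF True])
    also have "\<dots> \<le> (\<bar>C\<bar> + D) / t\<^sup>2" using D t by (intro divide_right_mono) auto
    also have "\<dots> \<le> (\<bar>C\<bar> + D) / ((1 + t\<^sup>2) / 2)"
      using D t by (intro divide_left_mono mult_pos_pos) (auto intro: add_pos_nonneg)
    finally show ?thesis by (simp add: field_simps)
  next
    case False
    then have t: "t\<^sup>2 \<le> 1" by (simp add: abs_square_le_1)
    have "norm (f t) \<le> D" using False by (intro D) auto
    also have "\<dots> \<le> (\<bar>C\<bar> + D) / ((1 + t\<^sup>2) / 2)"
    proof (subst pos_le_divide_eq)
      have "D * ((1 + t\<^sup>2) / 2) \<le> D * 1" using D t by (intro mult_left_mono) auto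
      then show "D * ((1 + t\<^sup>2) / 2) \<le> \<bar>C\<bar> + D" by simp
    qed (simp add: add_pos_nonneg)
    finally show ?thesis by (simp add: field_simps)
  qed
  have "integrable lborel (\<lambda>t. 2 * (\<bar>C\<bar> + D) * inverse (1 + t\<^sup>2) :: real)"
    using integrable_inverse_1_plus_square by (intro integrable_mult_right) (simp add: set_integrable_def einterval_def)
  then show ?thesis
  proof (rule Bochner_Integration.integrable_bound)
    show "f \<in> borel_measurable lborel" using cont by (simp add: borel_measurable_continuous_onI)
    show "AE t in lborel. norm (f t) \<le> norm (2 * (\<bar>C\<bar> + D) * inverse (1 + t\<^sup>2))"
      unfolding real_norm_def by (intro AE_I2 order_trans[OF bound abs_ge_self])
  qed
qed

section \<open>The Mellin transform of the variance-gamma density\<close>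

lemma borel_measurable_cosh [measurable]:
  fixes f :: "'a \<Rightarrow> real"
  assumes "f \<in> borel_measurable M"
  shows "(\<lambda>x. cosh (f x)) \<in> borel_measurable M"
  using assms by (rule borel_measurable_continuous_on[rotated]) (intro continuous_intros)

text \<open>In the coordinates \<open>p = y + t\<close>, \<open>q = y - t\<close> the integrand is a
  product, and the Jacobian gives the factor 1/2. Instead of a planar change of variables, two
  affine substitutions on the line are combined with Fubini: \<open>y = q + t\<close> for fixed
  \<open>t\<close>, then \<open>p = q + 2 * t\<close> for fixed \<open>q\<close>.\<close>

lemma
  fixes g h :: "real \<Rightarrow> complex"
  assumes g: "integrable lborel g" and h: "integrable lborel h"
  shows integrable_rotate: "integrable (lborel \<Otimes>\<^sub>M lborel) (\<lambda>(y, t). g (y + t) * h (y - t))"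
    and integral_rotate: "(\<integral>y. (\<integral>t. g (y + t) * h (y - t) \<partial>lborel) \<partial>lborel)
          = integral\<^sup>L lborel g * integral\<^sup>L lborel h / 2"
proof -
  have [measurable]: "g \<in> borel_measurable borel" "h \<in> borel_measurable borel"
    using g h by (auto dest: borel_measurable_integrable)
  have aff: "integrable lborel (\<lambda>t. g (q + 2 * t))" for q
    using lborel_integrable_real_affine[OF g, of 2 q] by simp
  have affI: "(\<integral>t. f (q + 2 * t) \<partial>lborel) = integral\<^sup>L lborel f / 2" for q and f :: "real \<Rightarrow> complex"
    using lborel_integral_real_affine[of 2 f q] by (simp add: scaleR_conv_of_real)
  have affI': "(\<integral>t. f (q + 2 * t) \<partial>lborel) = integral\<^sup>L lborel f / 2" for q and f :: "real \<Rightarrow> real"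
    using lborel_integral_real_affine[of 2 f q] by simp
  \<comment> \<open>Integrability is visible in the mixed coordinates \<open>(q, t)\<close>: the
    inner integral of the norm of \<open>g (q + 2 * t)\<close> over \<open>t\<close> does not depend
    on \<open>q\<close>.\<close>
  have 1: "integrable (lborel \<Otimes>\<^sub>M lborel) (\<lambda>(q, t). h q * g (q + 2 * t))"
  proof (rule lborel_pair.Fubini_integrable)
    show "integrable lborel (\<lambda>q. \<integral>t. norm (case (q, t) of (q, t) \<Rightarrow> h q * g (q + 2 * t)) \<partial>lborel)"
      using h by (simp add: norm_mult affI'[of "\<lambda>x. norm (g x)"])
    show "AE q in lborel. integrable lborel (\<lambda>t. case (q, t) of (q, t) \<Rightarrow> h q * g (q + 2 * t))"
      using aff by auto
  qed measurable
  have K1: "integrable (lborel \<Otimes>\<^sub>M lborel) (\<lambda>(t, q). h q * g (q + 2 * t))"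
    using lborel_pair.integrable_product_swap[OF 1] by simp
  have sh: "integrable lborel (\<lambda>y. f (y - t)) \<longleftrightarrow> integrable lborel f" for t and f :: "real \<Rightarrow> complex"
    using lborel_integrable_real_affine_iff[of 1 f "-t"] by simp
  have shI: "(\<integral>y. f (y - t) \<partial>lborel) = integral\<^sup>L lborel f" for t and f :: "real \<Rightarrow> complex"
    using lborel_integral_real_affine[of 1 f "-t"] by simp
  have shI': "(\<integral>y. f (y - t) \<partial>lborel) = integral\<^sup>L lborel f" for t and f :: "real \<Rightarrow> real"
    using lborel_integral_real_affine[of 1 f "-t"] by simp
  have 2: "integrable (lborel \<Otimes>\<^sub>M lborel) (\<lambda>(t, y). g (y + t) * h (y - t))"
  proof (rule lborel_pair.Fubini_integrable)
    have "(\<integral>y. norm (g (y + t) * h (y - t)) \<partial>lborel) = (\<integral>q. norm (h q * g (q + 2 * t)) \<partial>lborel)" for t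
      using shI'[of "\<lambda>q. norm (h q * g (q + 2 * t))" t] by (simp add: algebra_simps)
    then show "integrable lborel (\<lambda>t. \<integral>y. norm (case (t, y) of (t, y) \<Rightarrow> g (y + t) * h (y - t)) \<partial>lborel)"
      using lborel_pair.integrable_fst[of "\<lambda>t q. norm (h q * g (q + 2 * t))"] integrable_norm[OF K1]
      by (simp add: prod.case_distrib)
    have "AE t in lborel. integrable lborel (\<lambda>q. h q * g (q + 2 * t))"
      using lborel_pair.AE_integrable_fst[of "\<lambda>t q. h q * g (q + 2 * t)"] K1 by simp
    then show "AE t in lborel. integrable lborel (\<lambda>y. case (t, y) of (t, y) \<Rightarrow> g (y + t) * h (y - t))"
    proof eventually_elim
      case (elim t)
      then show ?case using sh[of "\<lambda>q. h q * g (q + 2 * t)" t] by (simp add: algebra_simps)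
    qed
  qed measurable
  show 3: "integrable (lborel \<Otimes>\<^sub>M lborel) (\<lambda>(y, t). g (y + t) * h (y - t))"
    using lborel_pair.integrable_product_swap[OF 2] by simp
  have "(\<integral>y. (\<integral>t. g (y + t) * h (y - t) \<partial>lborel) \<partial>lborel) = (\<integral>t. (\<integral>y. g (y + t) * h (y - t) \<partial>lborel) \<partial>lborel)"
    using lborel_pair.Fubini_integral[of "\<lambda>t y. g (y + t) * h (y - t)"] 2 by simp
  also have "\<dots> = (\<integral>t. (\<integral>q. h q * g (q + 2 * t) \<partial>lborel) \<partial>lborel)"
  proof (rule Bochner_Integration.integral_cong[OF refl])
    fix t
    show "(\<integral>y. g (y + t) * h (y - t) \<partial>lborel) = (\<integral>q. h q * g (q + 2 * t) \<partial>lborel)"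
      using shI[of "\<lambda>q. h q * g (q + 2 * t)" t] by (simp add: algebra_simps)
  qed
  also have "\<dots> = (\<integral>q. (\<integral>t. h q * g (q + 2 * t) \<partial>lborel) \<partial>lborel)"
    using lborel_pair.Fubini_integral[of "\<lambda>q t. h q * g (q + 2 * t)"] 1 by simp
  also have "\<dots> = (\<integral>q. h q * (integral\<^sup>L lborel g / 2) \<partial>lborel)"
    by (simp add: affI)
  also have "\<dots> = integral\<^sup>L lborel g * integral\<^sup>L lborel h / 2"
    by simp
  finally show "(\<integral>y. (\<integral>t. g (y + t) * h (y - t) \<partial>lborel) \<partial>lborel) = \<dots>" .
qed

text \<open>Folding the line at 0 turns \<open>exp (m * t)\<close> into
  \<open>2 * cosh (m * t)\<close>. The whole-line form is the useful one, since a pure exponential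
  factorises in the coordinates \<open>y + t\<close> and \<open>y - t\<close>.\<close>

lemma bessel_K_eq_LBINT:
  assumes "integrable lborel (\<lambda>t. exp (m * t - x * cosh t))"
  shows "bessel_K m x = (\<integral>t. exp (m * t - x * cosh t) \<partial>lborel) / 2"
proof -
  let ?e = "\<lambda>t. exp (m * t - x * cosh t)"
  have i: "integrable lborel (\<lambda>t. ?e (- t))"
    using assms lborel_integrable_real_affine_iff[of "-1" ?e 0] by simp
  have int: "set_integrable lborel {0..} ?e" "set_integrable lborel {0..} (\<lambda>t. ?e (- t))"
    unfolding set_integrable_def using assms i by (intro integrable_mult_indicator; simp)+
  have neg: "set_integrable lborel {..0} ?e"
    unfolding set_integrable_def using assms by (intro integrable_mult_indicator; simp)
  have "(\<integral>t. ?e t \<partial>lborel) = (LBINT t:{..0} \<union> {0<..}. ?e t)"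
  proof -
    have "{..0} \<union> {0<..} = (UNIV :: real set)" by auto
    then show ?thesis by (simp add: set_lebesgue_integral_def)
  qed
  also have "\<dots> = (LBINT t:{..0}. ?e t) + (LBINT t:{0<..}. ?e t)"
    by (intro set_integral_Un neg set_integrable_subset[OF int(1)]) auto
  also have "(LBINT t:{0<..}. ?e t) = (LBINT t:{0..}. ?e t)"
    unfolding set_lebesgue_integral_def
    by (intro integral_cong_AE eventually_mono[OF AE_lborel_singleton[of 0]]) (auto simp: indicator_def)
  also have "(LBINT t:{..0}. ?e t) = (LBINT t:{0..}. ?e (- t))"
    unfolding set_lebesgue_integral_def
    by (subst lborel_integral_real_affine[where c="-1" and t=0])
       (auto intro!: Bochner_Integration.integral_cong split: split_indicator)
  also have "(LBINT t:{0..}. ?e (- t)) + (LBINT t:{0..}. ?e t) = (LBINT t:{0..}. ?e (- t) + ?e t)"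
    by (rule set_integral_add(2)[symmetric, OF int(2,1)])
  also have "\<dots> = (LBINT t:{0..}. 2 * (exp (- x * cosh t) * cosh (m * t)))"
  proof -
    have "?e (- t) + ?e t = 2 * (exp (- x * cosh t) * cosh (m * t))" for t
      by (simp add: cosh_def[of "m * t"] exp_diff exp_minus field_simps)
    then show ?thesis by simp
  qed
  also have "\<dots> = 2 * bessel_K m x"
    by (simp add: bessel_K_def)
  finally show ?thesis by simp
qed

text \<open>Since \<open>exp y * cosh t\<close> is half the sum of \<open>exp (y + t)\<close> and
  \<open>exp (y - t)\<close>, the double integral rotates into a product of two Gamma integrals with
  parameters \<open>a\<close> and \<open>b\<close>; \<open>Re v > \<bar>m\<bar>\<close> says that
  both have positive real part. The power of 2 is \<open>a + b = v\<close> from the scale 2, minus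
  one for the Jacobian and one for the half in front of the whole-line form of
  \<open>bessel_K\<close>.\<close>

lemma has_bochner_integral_bessel_K_exp:
  fixes v :: complex
  assumes "Re v > \<bar>m\<bar>"
  shows "has_bochner_integral lborel (\<lambda>y. bessel_K m (exp y) *\<^sub>R exp (v * of_real y))
    (exp ((v - 2) * of_real (ln 2)) * Gamma ((v - of_real m) / 2) * Gamma ((v + of_real m) / 2))"
proof -
  define a b where "a = (v + of_real m) / 2" and "b = (v - of_real m) / 2"
  have ab: "a + b = v" "a - b = of_real m" by (simp_all add: a_def b_def field_simps)
  have pos: "Re a > 0" "Re b > 0" using assms by (simp_all add: a_def b_def)
  define g h where "g = (\<lambda>p. exp (a * of_real p - of_real (exp p / 2)))"
    and "h = (\<lambda>p. exp (b * of_real p - of_real (exp p / 2)))"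
  have gi: "has_bochner_integral lborel g (exp (a * of_real (ln 2)) * Gamma a)"
    unfolding g_def by (rule has_bochner_integral_Gamma_exp) (use pos in auto)
  have hi: "has_bochner_integral lborel h (exp (b * of_real (ln 2)) * Gamma b)"
    unfolding h_def by (rule has_bochner_integral_Gamma_exp) (use pos in auto)
  have gh: "integrable lborel g" "integrable lborel h" using gi hi by (auto simp: has_bochner_integral_iff)
  have E: "g (y + t) * h (y - t) = exp (m * t - exp y * cosh t) *\<^sub>R exp (v * of_real y)" for y t
  proof -
    have "g (y + t) * h (y - t) = exp ((a + b) * of_real y + (a - b) * of_real t
       - of_real (exp (y + t) / 2 + exp (y - t) / 2))"
      by (simp add: g_def h_def algebra_simps flip: exp_add)
    also have "exp (y + t) / 2 + exp (y - t) / 2 = exp y * cosh t"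
      by (simp add: cosh_def exp_add exp_diff exp_minus field_simps)
    finally show ?thesis
      by (simp add: ab scaleR_conv_of_real exp_of_real algebra_simps flip: exp_add exp_of_real)
  qed
  let ?I = "\<lambda>y. \<integral>t. g (y + t) * h (y - t) \<partial>lborel"
  \<comment> \<open>Fubini yields integrability in \<open>t\<close> for almost every
    \<open>y\<close>, which is enough to identify the inner integral with \<open>bessel_K\<close>
    inside an integral over \<open>y\<close>.\<close>
  have "AE y in lborel. integrable lborel (\<lambda>t. g (y + t) * h (y - t))"
    using lborel_pair.AE_integrable_fst[of "\<lambda>y t. g (y + t) * h (y - t)"] integrable_rotate[OF gh] by simp
  then have AE: "AE y in lborel. ?I y / 2 = bessel_K m (exp y) *\<^sub>R exp (v * of_real y)"
  proof eventually_elim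
    case (elim y)
    then have i: "integrable lborel (\<lambda>t. exp (m * t - exp y * cosh t))"
      using integrable_norm[OF elim] unfolding E by simp
    show ?case unfolding E bessel_K_eq_LBINT[OF i] using i by (simp add: scaleR_conv_of_real)
  qed
  have meas: "(\<lambda>y. bessel_K m (exp y) *\<^sub>R exp (v * of_real y)) \<in> borel_measurable lborel"
    unfolding bessel_K_def set_lebesgue_integral_def by measurable
  have "integrable lborel (\<lambda>y. ?I y / 2)"
    using lborel_pair.integrable_fst[of "\<lambda>y t. g (y + t) * h (y - t)"] integrable_rotate[OF gh] by simp
  moreover have "(\<integral>y. ?I y / 2 \<partial>lborel) = exp ((v - 2) * of_real (ln 2)) * Gamma b * Gamma a"
  proof -
    have "(\<integral>y. ?I y / 2 \<partial>lborel) = exp (a * of_real (ln 2)) * Gamma a * (exp (b * of_real (ln 2)) * Gamma b) / 4"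
      using integral_rotate[OF gh] has_bochner_integral_integral_eq[OF gi] has_bochner_integral_integral_eq[OF hi]
      by (simp add: mult.commute)
    also have "\<dots> = exp ((a + b) * of_real (ln 2)) / 4 * Gamma b * Gamma a"
      by (simp add: algebra_simps exp_add)
    also have "exp ((a + b) * of_real (ln 2)) / 4 = exp ((v - 2) * complex_of_real (ln 2))"
    proof -
      have "exp (2 * ln 2) = (4::real)" by (simp add: exp_double)
      then have "exp (complex_of_real (2 * ln 2)) = 4" unfolding exp_of_real by simp
      then show ?thesis by (simp add: ab algebra_simps exp_diff)
    qed
    finally show ?thesis .
  qed
  ultimately have "has_bochner_integral lborel (\<lambda>y. ?I y / 2) (exp ((v - 2) * of_real (ln 2)) * Gamma b * Gamma a)"
    by (simp add: has_bochner_integral_iff)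
  then show ?thesis
    unfolding a_def[symmetric] b_def[symmetric]
    by (subst has_bochner_integral_cong_AE[OF _ _ AE_symmetric[OF AE]]) (use meas in \<open>auto dest: borel_measurable_has_bochner_integral\<close>)
qed

section \<open>Complex absolute moments of the variance-gamma law\<close>

lemma borel_measurable_bessel_K [measurable]: "bessel_K m \<in> borel_measurable borel"
  unfolding bessel_K_def set_lebesgue_integral_def by measurable

lemma borel_measurable_vg_density [measurable]: "vg_density m \<alpha> \<in> borel_measurable borel"
  unfolding vg_density_def by measurable

lemma vg_density_minus [simp]: "vg_density m \<alpha> (- x) = vg_density m \<alpha> x"
  by (simp add: vg_density_def)

lemma bessel_K_nonneg: "bessel_K m x \<ge> 0"
  unfolding bessel_K_def set_lebesgue_integral_def by (intro integral_nonneg_AE) auto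

lemma vg_density_nonneg:
  assumes "m > - 1/2"
  shows "vg_density m \<alpha> x \<ge> 0"
  using assms unfolding vg_density_def
  by (intro mult_nonneg_nonneg divide_nonneg_nonneg bessel_K_nonneg Gamma_real_nonneg) auto

text \<open>By evenness the integral is twice that over the half-line, where
  \<open>x = exp y / \<alpha>\<close> reduces it to the Bessel integral. The Jacobian and the factor
  \<open>\<bar>x\<bar> powr m\<close> raise the exponent from \<open>u\<close> to
  \<open>v = u + m + 1\<close>; the two bounds on \<open>Re u\<close> together say
  \<open>Re v > \<bar>m\<bar>\<close>.\<close>

lemma has_bochner_integral_vg_density:
  fixes u :: complex
  assumes "\<alpha> > 0" "Re u > - 1" "Re u > - 1 - 2 * m"
  shows "has_bochner_integral lborel (\<lambda>x. vg_density m \<alpha> x *\<^sub>R exp (u * of_real (ln (\<alpha> * \<bar>x\<bar>))))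
    (exp (u * of_real (ln 2)) * Gamma ((u + 1) / 2) * Gamma (of_real m + (u + 1) / 2)
       / of_real (sqrt pi * Gamma (m + 1/2)))"
proof -
  define f where "f = (\<lambda>x. vg_density m \<alpha> x *\<^sub>R exp (u * complex_of_real (ln (\<alpha> * \<bar>x\<bar>))))"
  define v where "v = u + of_real m + 1"
  define C where "C = 1 / (sqrt pi * 2 powr m * Gamma (m + 1/2))"
  have [measurable]: "f \<in> borel_measurable borel" unfolding f_def by measurable
  have v: "Re v > \<bar>m\<bar>" using assms by (auto simp: v_def abs_if)
  have eq: "(1 / \<alpha> * exp y) *\<^sub>R f (1 / \<alpha> * exp y) = C *\<^sub>R (bessel_K m (exp y) *\<^sub>R exp (v * of_real y))" for y
  proof -
    have "1 / \<alpha> * exp y * vg_density m \<alpha> (1 / \<alpha> * exp y)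
        = 1 / (sqrt pi * Gamma (m + 1/2)) * ((1 / \<alpha> * exp y) * \<alpha> powr (2 * m + 1) / (2 * \<alpha>) powr m * (1 / \<alpha> * exp y) powr m) * bessel_K m (exp y)"
      using assms by (simp add: vg_density_def abs_mult mult_ac)
    \<comment> \<open>The powers of \<open>\<alpha>\<close> cancel: the exponents are
      \<open>- 1\<close>, \<open>2 * m + 1\<close>, \<open>- m\<close> and \<open>- m\<close>. Only
      a power of 2 and \<open>exp ((m + 1) * y)\<close> survive.\<close>
    also have "(1 / \<alpha> * exp y) * \<alpha> powr (2 * m + 1) / (2 * \<alpha>) powr m * (1 / \<alpha> * exp y) powr m
       = exp (- ln \<alpha> + y + (2 * m + 1) * ln \<alpha> - m * (ln 2 + ln \<alpha>) + m * (y - ln \<alpha>))"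
      using assms by (simp add: powr_def ln_mult ln_div exp_add exp_diff exp_minus field_simps) (simp add: algebra_simps flip: exp_add)
    also have "\<dots> = exp ((m + 1) * y) / 2 powr m"
      by (simp add: powr_def algebra_simps flip: exp_diff)
    finally have *: "1 / \<alpha> * exp y * vg_density m \<alpha> (1 / \<alpha> * exp y) = C * (bessel_K m (exp y) * exp ((m + 1) * y))"
      by (simp add: C_def field_simps)
    have "exp (u * complex_of_real (ln (\<alpha> * \<bar>1 / \<alpha> * exp y\<bar>))) = exp (u * of_real y)"
      using assms by (simp add: abs_mult)
    then have "(1 / \<alpha> * exp y) *\<^sub>R f (1 / \<alpha> * exp y) = (C * (bessel_K m (exp y) * exp ((m + 1) * y))) *\<^sub>R exp (u * of_real y)"
      unfolding f_def using * by (metis scaleR_scaleR)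
    also have "\<dots> = C *\<^sub>R (bessel_K m (exp y) *\<^sub>R (exp ((m + 1) * y) *\<^sub>R exp (u * of_real y)))"
      by simp
    also have "exp ((m + 1) * y) *\<^sub>R exp (u * of_real y) = exp (v * of_real y)"
      by (simp add: v_def scaleR_conv_of_real algebra_simps exp_add flip: exp_of_real)
    finally show ?thesis .
  qed
  define I where "I = exp ((v - 2) * of_real (ln 2)) * Gamma ((v - of_real m) / 2) * Gamma ((v + of_real m) / 2)"
  have "has_bochner_integral lborel (\<lambda>y. (1 / \<alpha> * exp y) *\<^sub>R f (1 / \<alpha> * exp y)) (C *\<^sub>R I)"
    unfolding eq I_def by (intro has_bochner_integral_scaleR_right has_bochner_integral_bessel_K_exp v)
  then have i: "integrable lborel (\<lambda>y. (1 / \<alpha> * exp y) *\<^sub>R f (1 / \<alpha> * exp y))"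
    and I: "(\<integral>y. (1 / \<alpha> * exp y) *\<^sub>R f (1 / \<alpha> * exp y) \<partial>lborel) = C *\<^sub>R I"
    by (auto simp: has_bochner_integral_iff)
  have "set_integrable lborel {0<..} f" "(LINT x:{0<..}|lborel. f x) = C *\<^sub>R I"
    using set_integrable_exp_substitution_iff[of "1 / \<alpha>" f] LBINT_exp_substitution[of "1 / \<alpha>" f] i I assms(1) by auto
  then have "has_bochner_integral lborel (\<lambda>x. indicator {0<..} x *\<^sub>R f x) (C *\<^sub>R I)"
    by (simp add: has_bochner_integral_iff set_integrable_def set_lebesgue_integral_def)
  \<comment> \<open>The rule for even functions integrates over \<open>{0..}\<close>; the added
    point is a null set, whatever default \<open>ln\<close> takes there.\<close>
  then have "has_bochner_integral lborel (\<lambda>x. indicator {0..} x *\<^sub>R f x) (C *\<^sub>R I)"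
    by (rule has_bochner_integral_discrete_difference[where X="{0}", THEN iffD1, rotated 4])
       (auto split: split_indicator)
  then have "has_bochner_integral lborel f (2 *\<^sub>R (C *\<^sub>R I))"
    by (rule has_bochner_integral_even_function) (simp add: f_def)
  moreover have "2 *\<^sub>R (C *\<^sub>R I) = exp (u * of_real (ln 2)) * Gamma ((u + 1) / 2) * Gamma (of_real m + (u + 1) / 2)
       / of_real (sqrt pi * Gamma (m + 1/2))"
  proof -
    have "exp ((v - 2) * of_real (ln 2)) = exp (u * complex_of_real (ln 2)) * exp (of_real (m * ln 2)) / exp (of_real (ln 2))"
      by (simp add: v_def algebra_simps exp_add exp_diff flip: exp_of_real)
    also have "\<dots> = exp (u * complex_of_real (ln 2)) * of_real (2 powr m) / 2"
      unfolding exp_of_real by (simp add: powr_def)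
    finally have "I = exp (u * complex_of_real (ln 2)) * of_real (2 powr m) / 2 * Gamma ((u + 1) / 2) * Gamma (of_real m + (u + 1) / 2)"
      by (simp add: I_def v_def add_divide_distrib algebra_simps)
    then show ?thesis
      by (simp add: C_def scaleR_conv_of_real field_simps)
  qed
  ultimately show ?thesis unfolding f_def by simp
qed

section \<open>Contour integrals along paths to infinity\<close>

text \<open>The segments have length at most \<open>2 * B\<close>, while the integrand on them is of
  the order of the inverse height.\<close>

lemma contour_integral_horizontal_tendsto_0:
  fixes a b :: "'a \<Rightarrow> complex"
  assumes bound: "\<And>w. \<bar>Re w\<bar> \<le> B \<Longrightarrow> \<bar>Im w\<bar> \<ge> 1 \<Longrightarrow> norm (g w) \<le> C / \<bar>Im w\<bar>"
    and Re: "\<And>x. \<bar>Re (a x)\<bar> \<le> B" "\<And>x. \<bar>Re (b x)\<bar> \<le> B" and Im: "\<And>x. Im (a x) = Im (b x)"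
    and lim: "filterlim (\<lambda>x. \<bar>Im (a x)\<bar>) at_top F"
  shows "((\<lambda>x. contour_integral (linepath (a x) (b x)) g) \<longlongrightarrow> 0) F"
proof (rule Lim_null_comparison)
  have "((\<lambda>x. \<bar>C\<bar> * (2 * B) / \<bar>Im (a x)\<bar>) \<longlongrightarrow> 0) F"
    by (intro tendsto_divide_0[OF tendsto_const] filterlim_at_top_imp_at_infinity lim)
  then show "((\<lambda>x. \<bar>C\<bar> / \<bar>Im (a x)\<bar> * (2 * B)) \<longlongrightarrow> 0) F" by simp
  have "eventually (\<lambda>x. \<bar>Im (a x)\<bar> \<ge> 1) F"
    using lim by (simp add: filterlim_at_top)
  then show "eventually (\<lambda>x. norm (contour_integral (linepath (a x) (b x)) g) \<le> \<bar>C\<bar> / \<bar>Im (a x)\<bar> * (2 * B)) F"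
  proof eventually_elim
    case (elim x)
    have B: "B \<ge> 0" using Re(1)[of x] by simp
    \<comment> \<open>If the contour integral does not exist, \<open>contour_integral\<close> is
      \<open>0\<close> by default and the bound holds because \<open>B\<close> is
      nonnegative.\<close>
    show ?case
    proof (cases "g contour_integrable_on linepath (a x) (b x)")
      case True
      have "norm (g w) \<le> \<bar>C\<bar> / \<bar>Im (a x)\<bar>" if "w \<in> closed_segment (a x) (b x)" for w
      proof -
        from that[unfolded in_segment] obtain u
          where u': "0 \<le> u \<and> u \<le> 1 \<and> w = (1 - u) *\<^sub>R a x + u *\<^sub>R b x" ..
        note u = u'[THEN conjunct1] u'[THEN conjunct2, THEN conjunct1] u'[THEN conjunct2, THEN conjunct2]
        have "Im w = (1 - u) * Im (a x) + u * Im (a x)" unfolding u(3) by (simp add: Im)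
        then have I: "Im w = Im (a x)" by (simp add: algebra_simps)
        have "\<bar>Re w\<bar> \<le> \<bar>(1 - u) * Re (a x)\<bar> + \<bar>u * Re (b x)\<bar>"
          unfolding u(3) by (simp add: abs_triangle_ineq)
        also have "\<dots> = (1 - u) * \<bar>Re (a x)\<bar> + u * \<bar>Re (b x)\<bar>"
          using u(1,2) by (simp add: abs_mult)
        also have "\<dots> \<le> (1 - u) * B + u * B"
          using u(1,2) Re[of x] by (intro add_mono mult_left_mono) auto
        also have "\<dots> = B" by (simp add: algebra_simps)
        finally have "norm (g w) \<le> C / \<bar>Im (a x)\<bar>"
          using bound[of w] elim unfolding I by blast
        also have "\<dots> \<le> \<bar>C\<bar> / \<bar>Im (a x)\<bar>" by (intro divide_right_mono) auto
        finally show ?thesis .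
      qed
      then have "norm (contour_integral (linepath (a x) (b x)) g) \<le> \<bar>C\<bar> / \<bar>Im (a x)\<bar> * norm (b x - a x)"
        by (intro contour_integral_bound_linepath[OF True]) auto
      also have "\<dots> \<le> \<bar>C\<bar> / \<bar>Im (a x)\<bar> * (2 * B)"
      proof (rule mult_left_mono)
        have "b x - a x = of_real (Re (b x) - Re (a x))" using Im[of x] by (simp add: complex_eq_iff)
        then have "norm (b x - a x) = \<bar>Re (b x) - Re (a x)\<bar>" by (simp only: norm_of_real)
        also have "\<dots> \<le> 2 * B" using Re[of x] by linarith
        finally show "norm (b x - a x) \<le> 2 * B" .
      qed auto
      finally show ?thesis .
    qed (use B in \<open>simp add: not_integrable_contour_integral\<close>)
  qed
qed

text \<open>The two ends move independently along an arbitrary filter, so the integral is split at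
  height 0 and each half treated as a one-sided limit.\<close>

lemma contour_integral_vertical_tendsto:
  assumes int: "integrable lborel (\<lambda>t. f (Complex c t))"
    and p: "filterlim p at_bot F" and q: "filterlim q at_top F"
  shows "((\<lambda>x. contour_integral (linepath (Complex c (p x)) (Complex c (q x))) f)
    \<longlongrightarrow> \<i> * (\<integral>t. f (Complex c t) \<partial>lborel)) F"
proof -
  let ?g = "\<lambda>t. f (Complex c t)"
  have si: "set_integrable lborel A ?g" if "A \<in> sets borel" for A
    unfolding set_integrable_def using that int by (intro integrable_mult_indicator) auto
  have lims: "((\<lambda>x. LBINT t:{p x..0}. ?g t) \<longlongrightarrow> (LBINT t:{..0}. ?g t)) F"
    "((\<lambda>x. LBINT t:{0..q x}. ?g t) \<longlongrightarrow> (LBINT t:{0..}. ?g t)) F"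
    by (intro filterlim_compose[OF tendsto_set_lebesgue_integral_at_bot p]
       filterlim_compose[OF tendsto_set_lebesgue_integral_at_top q] si; simp)+
  have "(\<integral>t. ?g t \<partial>lborel) = (LBINT t:{..0} \<union> {0<..}. ?g t)"
  proof -
    have "{..0} \<union> {0<..} = (UNIV :: real set)" by auto
    then show ?thesis by (simp add: set_lebesgue_integral_def)
  qed
  also have "\<dots> = (LBINT t:{..0}. ?g t) + (LBINT t:{0<..}. ?g t)"
    by (intro set_integral_Un si) auto
  also have "(LBINT t:{0<..}. ?g t) = (LBINT t:{0..}. ?g t)"
    unfolding set_lebesgue_integral_def using int
    by (intro integral_cong_AE eventually_mono[OF AE_lborel_singleton[of 0]]) (auto simp: indicator_def)
  finally have eq: "(\<integral>t. ?g t \<partial>lborel) = (LBINT t:{..0}. ?g t) + (LBINT t:{0..}. ?g t)" .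
  have "((\<lambda>x. \<i> * ((LBINT t:{p x..0}. ?g t) + (LBINT t:{0..q x}. ?g t))) \<longlongrightarrow> \<i> * (\<integral>t. ?g t \<partial>lborel)) F"
    unfolding eq by (intro tendsto_mult tendsto_const tendsto_add lims)
  moreover have "eventually (\<lambda>x. p x < 0) F" "eventually (\<lambda>x. q x > 0) F"
    using p q by (simp_all add: filterlim_at_bot_dense filterlim_at_top_dense)
  then have "eventually (\<lambda>x. \<i> * ((LBINT t:{p x..0}. ?g t) + (LBINT t:{0..q x}. ?g t))
      = contour_integral (linepath (Complex c (p x)) (Complex c (q x))) f) F"
  proof eventually_elim
    case (elim x)
    have "contour_integral (linepath (Complex c (p x)) (Complex c (q x))) f = \<i> * integral {p x..q x} ?g"
      using elim by (intro contour_integral_linepath_same_Re) auto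
    also have "integral {p x..q x} ?g = integral {p x..0} ?g + integral {0..q x} ?g"
      using elim set_borel_integral_eq_integral(1)[OF si[of "{p x..q x}"]]
      by (intro Henstock_Kurzweil_Integration.integral_combine[symmetric]) auto
    finally show ?case
      by (simp add: set_borel_integral_eq_integral(2)[OF si])
  qed
  ultimately show ?thesis by (rule Lim_transform_eventually)
qed

text \<open>On the line, \<open>1 / (w - z)\<close> has a logarithm as primitive. The sign
  \<open>\<sigma>\<close> moves the half-plane containing the line into the right half-plane, away
  from the branch cut, and there the imaginary part of the logarithm is an
  \<open>arctan\<close>.\<close>

lemma Re_winding_number_vertical:
  assumes "c \<noteq> Re z"
  shows "Re (winding_number (linepath (Complex c p) (Complex c q)) z)
    = (arctan ((q - Im z) / (c - Re z)) - arctan ((p - Im z) / (c - Re z))) / (2 * pi)"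
proof -
  define \<sigma> where "\<sigma> = sgn (c - Re z)"
  have \<sigma>: "\<sigma> * (c - Re z) > 0" "\<sigma> \<noteq> 0" "\<sigma> * \<sigma> = 1" using assms by (auto simp: \<sigma>_def sgn_if)
  let ?l = "linepath (Complex c p) (Complex c q)"
  let ?S = "{w. \<sigma> * (Re w - Re z) > 0}"
  let ?F = "\<lambda>w. Ln (of_real \<sigma> * (w - z))"
  have Rel: "Re w = c" if "w \<in> path_image ?l" for w
  proof -
    obtain u where "w = (1 - u) *\<^sub>R Complex c p + u *\<^sub>R Complex c q"
      using \<open>w \<in> path_image ?l\<close> unfolding path_image_linepath closed_segment_def by blast
    then have "Re w = (1 - u) * c + u * c" by simp
    then show ?thesis by (simp add: algebra_simps)
  qed
  have "((\<lambda>w. 1 / (w - z)) has_contour_integral (?F (pathfinish ?l) - ?F (pathstart ?l))) ?l"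
  proof (rule contour_integral_primitive)
    fix w assume "w \<in> ?S"
    then have w: "Re (of_real \<sigma> * (w - z)) > 0" by simp
    then have "of_real \<sigma> * (w - z) \<notin> \<real>\<^sub>\<le>\<^sub>0" "w \<noteq> z" by (auto simp: complex_nonpos_Reals_iff)
    then show "(?F has_field_derivative 1 / (w - z)) (at w within ?S)"
      using \<sigma> by (auto intro!: derivative_eq_intros simp: field_simps)
  qed (use Rel \<sigma> in auto)
  then have "winding_number ?l z = 1 / (2 * pi * \<i>) * (?F (Complex c q) - ?F (Complex c p))"
    using Rel assms by (subst winding_number_valid_path) (auto simp: contour_integral_unique)
  also have "\<dots> = - \<i> * (?F (Complex c q) - ?F (Complex c p)) / of_real (2 * pi)"
    by (simp add: field_simps)
  finally have "Re (winding_number ?l z) = Re (- \<i> * (?F (Complex c q) - ?F (Complex c p)) / of_real (2 * pi))"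
    by (rule arg_cong)
  also have "Re (- \<i> * A / of_real r) = Im A / r" for A r by (simp add: Re_divide_of_real)
  finally have "Re (winding_number ?l z) = (Im (?F (Complex c q)) - Im (?F (Complex c p))) / (2 * pi)"
    by (simp only: minus_complex.sel)
  moreover have "Im (?F (Complex c y)) = arctan ((y - Im z) / (c - Re z))" for y
  proof -
    let ?v = "of_real \<sigma> * (Complex c y - z)"
    have R: "Re ?v > 0" using \<sigma> by simp
    then have nz: "?v \<noteq> 0" by (metis order_less_irrefl zero_complex.simps(1))
    have "Im (Ln ?v) = arctan (Im ?v / Re ?v)"
      using arg_conv_arctan[OF R] Arg_eq_Im_Ln[OF nz] by (simp only:)
    then show ?thesis using \<sigma> by simp
  qed
  ultimately show ?thesis by simp
qed

text \<open>The endpoints are left arbitrary because the result serves twice: for the line as an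
  integration path of its own, and for the vertical side of the loop that closes up another
  path.\<close>

lemma Re_winding_number_vertical_tendsto:
  assumes "c \<noteq> Re z" and p: "filterlim p at_bot F" and q: "filterlim q at_top F"
  shows "((\<lambda>x. Re (winding_number (linepath (Complex c (p x)) (Complex c (q x))) z))
    \<longlongrightarrow> (if Re z < c then 1/2 else - 1/2)) F"
proof -
  have q': "filterlim (\<lambda>x. q x - Im z) at_top F"
    using filterlim_tendsto_add_at_top[OF tendsto_const[of "- Im z"] q] by (simp add: algebra_simps)
  have p': "filterlim (\<lambda>x. p x - Im z) at_bot F"
    using filterlim_tendsto_add_at_bot_iff[OF tendsto_const[of "- Im z"], of p] p by (simp add: algebra_simps)
  show ?thesis
  proof (cases "Re z < c")
    case True
    have "((\<lambda>x. arctan ((q x - Im z) / (c - Re z))) \<longlongrightarrow> pi / 2) F"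
      using True filterlim_tendsto_pos_mult_at_top[OF tendsto_const[of "1 / (c - Re z)"] _ q']
      by (intro filterlim_compose[OF tendsto_arctan_at_top]) auto
    moreover have "((\<lambda>x. arctan ((p x - Im z) / (c - Re z))) \<longlongrightarrow> - (pi / 2)) F"
      using True filterlim_tendsto_pos_mult_at_bot[OF tendsto_const[of "1 / (c - Re z)"] _ p']
      by (intro filterlim_compose[OF tendsto_arctan_at_bot]) auto
    ultimately have "((\<lambda>x. (arctan ((q x - Im z) / (c - Re z)) - arctan ((p x - Im z) / (c - Re z))) / (2 * pi))
       \<longlongrightarrow> (pi / 2 - - (pi / 2)) / (2 * pi)) F"
      by (intro tendsto_divide tendsto_diff tendsto_const) auto
    then show ?thesis using True assms(1) by (simp add: Re_winding_number_vertical)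
  next
    case False
    then have neg: "1 / (c - Re z) < 0" using assms(1) by simp
    have "((\<lambda>x. arctan ((q x - Im z) / (c - Re z))) \<longlongrightarrow> - (pi / 2)) F"
      using filterlim_tendsto_neg_mult_at_bot[OF tendsto_const[of "1 / (c - Re z)"] neg q']
      by (intro filterlim_compose[OF tendsto_arctan_at_bot]) auto
    moreover have "((\<lambda>x. arctan ((p x - Im z) / (c - Re z))) \<longlongrightarrow> pi / 2) F"
      using filterlim_tendsto_neg_mult_at_top_iff[OF tendsto_const[of "1 / (c - Re z)"] neg, of "\<lambda>x. p x - Im z"] p'
      by (intro filterlim_compose[OF tendsto_arctan_at_top]) auto
    ultimately have "((\<lambda>x. (arctan ((q x - Im z) / (c - Re z)) - arctan ((p x - Im z) / (c - Re z))) / (2 * pi))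
       \<longlongrightarrow> (- (pi / 2) - pi / 2) / (2 * pi)) F"
      by (intro tendsto_divide tendsto_diff tendsto_const) auto
    then show ?thesis using False assms(1) by (simp add: Re_winding_number_vertical)
  qed
qed

text \<open>Here \<open>P\<close> is a closed set outside which \<open>f\<close> is holomorphic. As
  \<open>P\<close> lies on the real axis, horizontal segments at height at least 1 avoid it.
  First-order decay would do for these segments; the second order makes \<open>f\<close> integrable
  along the line.\<close>

lemma imag_infinity_path_integral_tendsto:
  fixes f :: "complex \<Rightarrow> complex" and P :: "complex set"
  assumes closed: "closed P" and holo: "f holomorphic_on - P"
    and real: "\<And>z. z \<in> P \<Longrightarrow> Im z = 0" and finite: "\<And>B. finite {z \<in> P. \<bar>Re z\<bar> \<le> B}"
    and decay: "\<And>B. \<exists>C. \<forall>w. \<bar>Re w\<bar> \<le> B \<longrightarrow> \<bar>Im w\<bar> \<ge> 1 \<longrightarrow> norm (f w) \<le> C / \<bar>Im w\<bar> ^ 2"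
    and c: "\<And>z. z \<in> P \<Longrightarrow> Re z \<noteq> c"
    and \<gamma>: "imag_infinity_path \<gamma>"
    and left: "\<And>z. z \<in> P \<Longrightarrow> Re z < c \<Longrightarrow> left_of_path \<gamma> z"
    and right: "\<And>z. z \<in> P \<Longrightarrow> Re z > c \<Longrightarrow> right_of_path \<gamma> z"
  shows "integrable lborel (\<lambda>t. f (Complex c t))"
    and "((\<lambda>(r, s). contour_integral (subpath r s \<gamma>) f) \<longlongrightarrow> \<i> * (\<integral>t. f (Complex c t) \<partial>lborel)) (at_bot \<times>\<^sub>F at_top)"
proof -
  let ?F = "at_bot \<times>\<^sub>F at_top :: (real \<times> real) filter"
  obtain C0 where C0: "\<bar>Re w\<bar> \<le> \<bar>c\<bar> \<Longrightarrow> \<bar>Im w\<bar> \<ge> 1 \<Longrightarrow> norm (f w) \<le> C0 / \<bar>Im w\<bar> ^ 2" for w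
    using decay[of "\<bar>c\<bar>"] by blast
  show int: "integrable lborel (\<lambda>t. f (Complex c t))"
  proof (rule integrable_if_bound_inverse_square)
    have "continuous_on (Complex c ` UNIV) f"
      by (rule continuous_on_subset[OF holomorphic_on_imp_continuous_on[OF holo]]) (use c in fastforce)
    then show "continuous_on UNIV (\<lambda>t. f (Complex c t))"
      by (rule continuous_on_compose2) (auto intro!: continuous_intros simp: Complex_eq)
    show "norm (f (Complex c t)) \<le> C0 / t\<^sup>2" if "\<bar>t\<bar> \<ge> 1" for t
      using C0[of "Complex c t"] that by simp
  qed
  have "bounded (range (\<lambda>t. Re (\<gamma> t)))" and vp: "\<And>r s. r < s \<Longrightarrow> valid_path (subpath r s \<gamma>)"
    and bot: "filterlim (\<lambda>t. Im (\<gamma> t)) at_bot at_bot" and top: "filterlim (\<lambda>t. Im (\<gamma> t)) at_top at_top"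
    using \<gamma> by (auto simp: imag_infinity_path_def)
  then obtain B0 where "\<And>t. \<bar>Re (\<gamma> t)\<bar> \<le> B0" by (auto simp: bounded_iff)
  then obtain B where B: "\<And>t. \<bar>Re (\<gamma> t)\<bar> \<le> B" "\<bar>c\<bar> \<le> B"
    by (metis max.coboundedI1 max.coboundedI2 order_refl)
  have avoid: "z \<notin> range \<gamma>" if "z \<in> P" for z
    using left[OF that] right[OF that] c[OF that] by (auto simp: left_of_path_def right_of_path_def neq_iff)
  define a b where "a = (\<lambda>x::real \<times> real. \<gamma> (fst x))" and "b = (\<lambda>x::real \<times> real. \<gamma> (snd x))"
  define a' b' where "a' = (\<lambda>x. Complex c (Im (a x)))" and "b' = (\<lambda>x. Complex c (Im (b x)))"
  define h1 h2 v where "h1 = (\<lambda>x. linepath (b x) (b' x))" and "h2 = (\<lambda>x. linepath (a' x) (a x))"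
    and "v = (\<lambda>x. linepath (a' x) (b' x))"
  define p where "p = (\<lambda>x::real \<times> real. subpath (fst x) (snd x) \<gamma>)"
  \<comment> \<open>The loop runs up the path, horizontally to the line, down the line, and
    horizontally back.\<close>
  define loop where "loop = (\<lambda>x. p x +++ (h1 x +++ (reversepath (v x) +++ h2 x)))"
  have lim_a: "filterlim (\<lambda>x. Im (a x)) at_bot ?F" and lim_b: "filterlim (\<lambda>x. Im (b x)) at_top ?F"
    unfolding a_def b_def by (rule filterlim_compose[OF bot filterlim_fst] filterlim_compose[OF top filterlim_snd])+
  have lim_abs: "filterlim (\<lambda>x. \<bar>Im (a x)\<bar>) at_top ?F" "filterlim (\<lambda>x. \<bar>Im (b x)\<bar>) at_top ?F"
    using filterlim_at_infinity_imp_norm_at_top[OF filterlim_at_bot_imp_at_infinity[OF lim_a]]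
      filterlim_at_infinity_imp_norm_at_top[OF filterlim_at_top_imp_at_infinity[OF lim_b]]
    by (simp_all only: real_norm_def)
  have ev: "eventually (\<lambda>x. fst x < snd x \<and> Im (a x) \<le> - 1 \<and> 1 \<le> Im (b x)) ?F"
  proof -
    have "eventually (\<lambda>x. fst x < 0) ?F" "eventually (\<lambda>x. snd x > 0) ?F"
      using filterlim_fst[of "at_bot :: real filter" "at_top :: real filter"] filterlim_snd[of "at_top :: real filter" "at_bot :: real filter"]
      by (auto simp: filterlim_at_bot_dense filterlim_at_top_dense)
    moreover have "eventually (\<lambda>x. Im (a x) \<le> - 1) ?F" "eventually (\<lambda>x. Im (b x) \<ge> 1) ?F"
      using lim_a lim_b by (auto simp: filterlim_at_bot filterlim_at_top)
    ultimately show ?thesis by eventually_elim auto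
  qed
  \<comment> \<open>Stated for a general \<open>g\<close> because it is applied to \<open>f\<close>
    and also to \<open>1 / (w - z)\<close>, whose integral gives the winding numbers of the
    segments.\<close>
  have horiz: "((\<lambda>x. contour_integral (h1 x) g) \<longlongrightarrow> 0) ?F" "((\<lambda>x. contour_integral (h2 x) g) \<longlongrightarrow> 0) ?F"
    if "\<And>w. \<bar>Re w\<bar> \<le> B \<Longrightarrow> \<bar>Im w\<bar> \<ge> 1 \<Longrightarrow> norm (g w) \<le> C / \<bar>Im w\<bar>" for g C
    unfolding h1_def h2_def a'_def b'_def
    by (rule contour_integral_horizontal_tendsto_0[of B g C]; use that B lim_abs in \<open>auto simp: a_def b_def\<close>)+
  obtain C1 where C1: "\<bar>Re w\<bar> \<le> B \<Longrightarrow> \<bar>Im w\<bar> \<ge> 1 \<Longrightarrow> norm (f w) \<le> C1 / \<bar>Im w\<bar> ^ 2" for w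
    using decay[of B] by blast
  have "norm (f w) \<le> \<bar>C1\<bar> / \<bar>Im w\<bar>" if "\<bar>Re w\<bar> \<le> B" "\<bar>Im w\<bar> \<ge> 1" for w
  proof -
    have "norm (f w) \<le> \<bar>C1\<bar> / \<bar>Im w\<bar> ^ 2"
      using C1[OF that] by (rule order_trans) (intro divide_right_mono; simp)
    also have "\<dots> \<le> \<bar>C1\<bar> / \<bar>Im w\<bar>"
      using that self_le_power[of "\<bar>Im w\<bar>" 2] by (intro divide_left_mono) (auto intro!: mult_pos_pos)
    finally show ?thesis .
  qed
  note f_horiz = horiz[OF this]
  have f_vert: "((\<lambda>x. contour_integral (v x) f) \<longlongrightarrow> \<i> * (\<integral>t. f (Complex c t) \<partial>lborel)) ?F"
    unfolding v_def a'_def b'_def by (rule contour_integral_vertical_tendsto[OF int lim_a lim_b])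
  have images: "path_image (p x) \<subseteq> range \<gamma>" "path_image (h1 x) \<subseteq> {w. Im w = Im (b x)}"
     "path_image (h2 x) \<subseteq> {w. Im w = Im (a x)}" "path_image (v x) \<subseteq> {w. Re w = c}" if "fst x < snd x" for x
  proof -
    show "path_image (p x) \<subseteq> range \<gamma>" using that by (auto simp: p_def path_image_subpath)
    have "convex {w. Im w = y}" "convex {w. Re w = y}" for y
      by (simp_all add: convex_def algebra_simps flip: distrib_right)
    then show "path_image (h1 x) \<subseteq> {w. Im w = Im (b x)}"
     "path_image (h2 x) \<subseteq> {w. Im w = Im (a x)}" "path_image (v x) \<subseteq> {w. Re w = c}"
      unfolding h1_def h2_def v_def path_image_linepath
      by (intro closed_segment_subset; simp add: a'_def b'_def)+
  qed
  have strip: "path_image (p x) \<subseteq> {w. \<bar>Re w\<bar> \<le> B}" "path_image (h1 x) \<subseteq> {w. \<bar>Re w\<bar> \<le> B}"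
     "path_image (h2 x) \<subseteq> {w. \<bar>Re w\<bar> \<le> B}" "path_image (v x) \<subseteq> {w. \<bar>Re w\<bar> \<le> B}" if "fst x < snd x" for x
  proof -
    show "path_image (p x) \<subseteq> {w. \<bar>Re w\<bar> \<le> B}" using images(1)[OF that] B(1) by auto
    have "convex {w. \<bar>Re w\<bar> \<le> B}"
    proof -
      have "{w. \<bar>Re w\<bar> \<le> B} = {w. Re w \<le> B} \<inter> {w. Re w \<ge> - B}" by auto
      then show ?thesis by (simp only: convex_Int convex_halfspace_Re_le convex_halfspace_Re_ge)
    qed
    then show "path_image (h1 x) \<subseteq> {w. \<bar>Re w\<bar> \<le> B}"
     "path_image (h2 x) \<subseteq> {w. \<bar>Re w\<bar> \<le> B}" "path_image (v x) \<subseteq> {w. \<bar>Re w\<bar> \<le> B}"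
      unfolding h1_def h2_def v_def path_image_linepath
      by (intro closed_segment_subset; simp add: a'_def b'_def a_def b_def B)+
  qed
  have ends: "pathfinish (p x) = b x" "pathstart (p x) = a x" for x
    by (simp_all add: p_def a_def b_def)
  have vps: "valid_path (p x)" "valid_path (h1 x)" "valid_path (h2 x)" "valid_path (v x)" if "fst x < snd x" for x
    using vp[OF that] by (simp_all add: p_def h1_def h2_def v_def)
  have vpl: "valid_path (loop x)" "pathfinish (loop x) = pathstart (loop x)" if "fst x < snd x" for x
    using vps[OF that] ends by (auto simp: loop_def h1_def h2_def v_def intro!: valid_path_join)
  have seg: "closed_segment (b' x) (a' x) = closed_segment (a' x) (b' x)" for x
    by (rule closed_segment_commute)
  have pil: "path_image (loop x) = path_image (p x) \<union> path_image (h1 x) \<union> path_image (v x) \<union> path_image (h2 x)" for x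
    by (simp add: loop_def path_image_join ends h1_def h2_def v_def seg Un_assoc)
  have off: "z \<notin> path_image (p x)" "z \<notin> path_image (h1 x)" "z \<notin> path_image (h2 x)" "z \<notin> path_image (v x)"
    if "z \<in> P" "fst x < snd x" "Im (a x) \<le> - 1" "1 \<le> Im (b x)" for x z
    using images[OF that(2)] avoid[OF that(1)] real[OF that(1)] c[OF that(1)] that(3,4) by auto
  have wn_loop: "winding_number (loop x) z = winding_number (p x) z + (winding_number (h1 x) z
       + (- winding_number (v x) z + winding_number (h2 x) z))"
    if "z \<in> P" "fst x < snd x" "Im (a x) \<le> - 1" "1 \<le> Im (b x)" for x z
  proof -
    note o = off[OF that] and v = vps[OF that(2), THEN valid_path_imp_path]
    have "winding_number (reversepath (v x) +++ h2 x) z = winding_number (reversepath (v x)) z + winding_number (h2 x) z"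
      using o v by (intro winding_number_join) (auto simp: v_def h2_def seg)
    moreover have "winding_number (h1 x +++ (reversepath (v x) +++ h2 x)) z
       = winding_number (h1 x) z + winding_number (reversepath (v x) +++ h2 x) z"
      using o v by (intro winding_number_join) (auto simp: v_def h2_def h1_def path_image_join seg)
    moreover have "winding_number (loop x) z
       = winding_number (p x) z + winding_number (h1 x +++ (reversepath (v x) +++ h2 x)) z"
      unfolding loop_def using o v ends
      by (intro winding_number_join) (auto simp: v_def h2_def h1_def path_image_join seg)
    ultimately show ?thesis using o v by (simp add: winding_number_reversepath)
  qed
  \<comment> \<open>The two vertical paths contribute \<open>\<plusminus>1/2\<close> with opposite signs and the horizontal segments
    nothing in the limit; integrality then makes the winding number of the loop exactly \<open>0\<close>.\<close>
  have wn0: "eventually (\<lambda>x. winding_number (loop x) z = 0) ?F" if z: "z \<in> P" for z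
  proof -
    have wh: "((\<lambda>x. Re (winding_number (h1 x) z)) \<longlongrightarrow> 0) ?F" "((\<lambda>x. Re (winding_number (h2 x) z)) \<longlongrightarrow> 0) ?F"
    proof -
      have "norm (1 / (w - z)) \<le> 1 / \<bar>Im w\<bar>" if "\<bar>Im w\<bar> \<ge> 1" for w
        using abs_Im_le_cmod[of "w - z"] real[OF z] that
        by (simp add: norm_divide) (intro divide_left_mono mult_pos_pos; linarith?)
      note 1 = horiz[of "\<lambda>w. 1 / (w - z)" 1, OF this]
      have 2: "((\<lambda>x. Re (1 / (2 * pi * \<i>) * contour_integral (h x) (\<lambda>w. 1 / (w - z)))) \<longlongrightarrow> Re (1 / (2 * pi * \<i>) * 0)) ?F"
        if "((\<lambda>x. contour_integral (h x) (\<lambda>w. 1 / (w - z))) \<longlongrightarrow> 0) ?F" for h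
        by (intro tendsto_Re tendsto_mult tendsto_const that)
      have 3: "eventually (\<lambda>x. Re (1 / (2 * pi * \<i>) * contour_integral (h1 x) (\<lambda>w. 1 / (w - z))) = Re (winding_number (h1 x) z)) ?F"
        "eventually (\<lambda>x. Re (1 / (2 * pi * \<i>) * contour_integral (h2 x) (\<lambda>w. 1 / (w - z))) = Re (winding_number (h2 x) z)) ?F"
        by (rule eventually_mono[OF ev], simp add: winding_number_valid_path vps off[OF z])+
      show "((\<lambda>x. Re (winding_number (h1 x) z)) \<longlongrightarrow> 0) ?F"
        using Lim_transform_eventually[OF 2[OF 1(1)] 3(1)] by simp
      show "((\<lambda>x. Re (winding_number (h2 x) z)) \<longlongrightarrow> 0) ?F"
        using Lim_transform_eventually[OF 2[OF 1(2)] 3(2)] by simp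
    qed
    let ?k = "if Re z < c then 1/2 else - 1/2 :: real"
    have wp: "((\<lambda>x. Re (winding_number (p x) z)) \<longlongrightarrow> ?k) ?F"
      using left[OF z] right[OF z] c[OF z]
      unfolding left_of_path_def right_of_path_def p_def case_prod_unfold
      by (cases "Re z < c") auto
    have wv: "((\<lambda>x. Re (winding_number (v x) z)) \<longlongrightarrow> ?k) ?F"
      unfolding v_def a'_def b'_def using c[OF z]
      by (intro Re_winding_number_vertical_tendsto lim_a lim_b) auto
    have "((\<lambda>x. Re (winding_number (p x) z) + (Re (winding_number (h1 x) z)
       + (- Re (winding_number (v x) z) + Re (winding_number (h2 x) z)))) \<longlongrightarrow> ?k + (0 + (- ?k + 0))) ?F"
      by (intro tendsto_add tendsto_minus wp wh wv)
    then have "eventually (\<lambda>x. \<bar>Re (winding_number (p x) z) + (Re (winding_number (h1 x) z)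
       + (- Re (winding_number (v x) z) + Re (winding_number (h2 x) z)))\<bar> < 1) ?F"
      by (intro order_tendstoD(2)[OF tendsto_rabs]) auto
    then show ?thesis using ev
    proof eventually_elim
      case (elim x)
      have "winding_number (loop x) z \<in> \<int>"
        using elim vpl[of x] off[OF z, of x] by (intro integer_winding_number) (auto simp: pil valid_path_imp_path)
      then obtain n where n: "winding_number (loop x) z = of_int n" by (auto elim: Ints_cases)
      have "\<bar>Re (winding_number (loop x) z)\<bar> < 1"
        using elim wn_loop[OF z, of x] by simp
      then show ?case unfolding n by simp
    qed
  qed
  \<comment> \<open>How far out the winding number becomes 0 depends on \<open>z\<close>. Finiteness
    of \<open>P\<close> inside the strip that contains every loop gives a common threshold.\<close>
  have "eventually (\<lambda>x. \<forall>z\<in>{z\<in>P. \<bar>Re z\<bar> \<le> B}. winding_number (loop x) z = 0) ?F"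
    using finite wn0 by (intro eventually_ball_finite) auto
  then have "eventually (\<lambda>x. contour_integral (v x) f - contour_integral (h1 x) f - contour_integral (h2 x) f = contour_integral (p x) f) ?F"
    using ev
  proof eventually_elim
    case (elim x)
    have sub: "path_image (p x) \<subseteq> - P" "path_image (h1 x) \<subseteq> - P" "path_image (h2 x) \<subseteq> - P" "path_image (v x) \<subseteq> - P"
      using off[of _ x] elim by blast+
    have oP: "open (- P)" using closed by auto
    have ci: "f contour_integrable_on (p x)" "f contour_integrable_on (h1 x)" "f contour_integrable_on (h2 x)"
       "f contour_integrable_on (v x)"
      using sub vps[of x] elim by (auto intro!: contour_integrable_holomorphic_simple[OF holo oP])
    have vx: "valid_path (p x)" "valid_path (h1 x)" "valid_path (h2 x)" "valid_path (v x)"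
      using vps[of x] elim by auto
    have "(f has_contour_integral 0) (loop x)"
    proof (rule Cauchy_theorem_global[OF oP holo])
      show "valid_path (loop x)" "pathfinish (loop x) = pathstart (loop x)" using vpl elim by auto
      show "path_image (loop x) \<subseteq> - P" unfolding pil using sub by blast
      fix w assume w: "w \<notin> - P"
      show "winding_number (loop x) w = 0"
      proof (cases "\<bar>Re w\<bar> \<le> B")
        \<comment> \<open>A point outside the strip is outside a convex set containing the loop, so
          its winding number is 0.\<close>
        case False
        have "convex {w. \<bar>Re w\<bar> \<le> B}"
        proof -
          have "{w. \<bar>Re w\<bar> \<le> B} = {w. Re w \<le> B} \<inter> {w. Re w \<ge> - B}" by auto
          then show ?thesis by (simp only: convex_Int convex_halfspace_Re_le convex_halfspace_Re_ge)
        qed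
        then show ?thesis
          using False strip[of x] elim vpl[of x]
          by (intro winding_number_zero_outside[of _ "{w. \<bar>Re w\<bar> \<le> B}"]) (auto simp: pil valid_path_imp_path)
      qed (use elim w in auto)
    qed
    then have "0 = contour_integral (loop x) f" by (simp add: contour_integral_unique)
    also have "\<dots> = contour_integral (p x) f + (contour_integral (h1 x) f + (- contour_integral (v x) f + contour_integral (h2 x) f))"
    proof -
      have "f contour_integrable_on (reversepath (v x))"
        using ci(4) vx(4) by (rule contour_integrable_reversepath[rotated])
      moreover have "valid_path (reversepath (v x))" using vx(4) by simp
      moreover have "contour_integral (linepath (b' x) (a' x)) f = - contour_integral (linepath (a' x) (b' x)) f"
        using contour_integral_reversepath[OF vx(4), of f] by (simp add: v_def)
      ultimately show ?thesis
        unfolding loop_def using ci vx ends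
        by (simp add: contour_integral_join contour_integral_reversepath contour_integrable_joinI valid_path_join v_def h1_def h2_def)
    qed
    finally show ?case by (simp add: algebra_simps)
  qed
  then have "((\<lambda>x. contour_integral (p x) f) \<longlongrightarrow> \<i> * (\<integral>t. f (Complex c t) \<partial>lborel) - 0 - 0) ?F"
    by (rule Lim_transform_eventually[rotated]) (intro tendsto_diff f_vert f_horiz)
  then show "((\<lambda>(r, s). contour_integral (subpath r s \<gamma>) f) \<longlongrightarrow> \<i> * (\<integral>t. f (Complex c t) \<partial>lborel)) ?F"
    unfolding p_def case_prod_unfold by simp
qed

section \<open>The Meijer G-function as an integral over a vertical line\<close>

lemma subpath_vertical: "subpath r s (Complex c) = linepath (Complex c r) (Complex c s)"
  by (auto simp: subpath_def linepath_def fun_eq_iff complex_eq_iff algebra_simps)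

lemma imag_infinity_path_vertical: "imag_infinity_path (Complex c)"
  unfolding imag_infinity_path_def subpath_vertical by (auto simp: inj_def filterlim_ident)

lemma left_of_path_vertical: "Re z < c \<Longrightarrow> left_of_path (Complex c) z"
  and right_of_path_vertical: "Re z > c \<Longrightarrow> right_of_path (Complex c) z"
  using Re_winding_number_vertical_tendsto[of c z fst "at_bot \<times>\<^sub>F at_top" snd] filterlim_fst filterlim_snd
  unfolding left_of_path_def right_of_path_def subpath_vertical case_prod_unfold by auto

section \<open>Poles and growth of the Gamma product\<close>

lemma finite_nonpos_Int_translates:
  fixes a :: complex
  shows "finite {s. a - s \<in> \<int>\<^sub>\<le>\<^sub>0 \<and> \<bar>Re s\<bar> \<le> B}"
proof -
  have "{s. a - s \<in> \<int>\<^sub>\<le>\<^sub>0 \<and> \<bar>Re s\<bar> \<le> B} \<subseteq> (\<lambda>k. a + of_nat k) ` {..nat \<lceil>B - Re a\<rceil>}"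
  proof
    fix s assume s: "s \<in> {s. a - s \<in> \<int>\<^sub>\<le>\<^sub>0 \<and> \<bar>Re s\<bar> \<le> B}"
    then obtain k where k: "a - s = - of_nat k" by (auto elim: nonpos_Ints_cases')
    then have "s = a + of_nat k" by (simp add: algebra_simps)
    moreover from this have "real k \<le> B - Re a" using s by auto
    then have "k \<le> nat \<lceil>B - Re a\<rceil>" by linarith
    ultimately show "s \<in> (\<lambda>k. a + of_nat k) ` {..nat \<lceil>B - Re a\<rceil>}" by blast
  qed
  then show ?thesis by (rule finite_subset) simp
qed

lemma finite_nonpos_Int_translates':
  fixes a :: complex
  shows "finite {s. a + s \<in> \<int>\<^sub>\<le>\<^sub>0 \<and> \<bar>Re s\<bar> \<le> B}"
proof -
  have "{s. a + s \<in> \<int>\<^sub>\<le>\<^sub>0 \<and> \<bar>Re s\<bar> \<le> B} = uminus ` {s. a - s \<in> \<int>\<^sub>\<le>\<^sub>0 \<and> \<bar>Re s\<bar> \<le> B}"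
    by (auto simp: image_iff intro!: exI[of _ "- _"])
  then show ?thesis using finite_nonpos_Int_translates by simp
qed

text \<open>Up to a constant this is the expectation of \<open>exp (- (2 * s + 1) * L)\<close> for
  the variable \<open>L\<close> of the overview. The integrand of the G-function has the further
  factors \<open>1 / (s + 1/2)\<close> and \<open>x powr s\<close>.\<close>

definition mellin_kernel :: "real \<Rightarrow> real \<Rightarrow> complex \<Rightarrow> complex" where
  "mellin_kernel m n s = Gamma (of_real m - s) * Gamma (- s) * (Gamma (1 + of_real n + s) * Gamma (1 + s))"

context
  fixes m n c :: real
  assumes mn: "m > - 1/2" "n > - 1/2" and c: "- 1/2 < c" "c < m" "c < 0"
begin

text \<open>One Gamma factor supplies the inverse square; the other three are only bounded by
  \<open>C\<close>, as \<open>\<bar>Im w\<bar> \<ge> 1\<close>.\<close>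

lemma mellin_kernel_bound:
  obtains C where "C > 0"
    "\<And>w. \<bar>Re w\<bar> \<le> B \<Longrightarrow> \<bar>Im w\<bar> \<ge> 1 \<Longrightarrow> norm (mellin_kernel m n w) \<le> C / \<bar>Im w\<bar> ^ 2"
proof -
  obtain C where C: "C > 0" "\<And>z. \<bar>Re z\<bar> \<le> B + \<bar>m\<bar> + \<bar>n\<bar> + 1 \<Longrightarrow> \<bar>Im z\<bar> \<ge> 1 \<Longrightarrow> norm (Gamma z) \<le> C / \<bar>Im z\<bar> ^ 2"
    by (rule Gamma_strip_bound[of "B + \<bar>m\<bar> + \<bar>n\<bar> + 1"]) blast
  have "norm (mellin_kernel m n w) \<le> C ^ 4 / \<bar>Im w\<bar> ^ 2" if w: "\<bar>Re w\<bar> \<le> B" "\<bar>Im w\<bar> \<ge> 1" for w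
  proof -
    have "1 \<le> \<bar>Im w\<bar> ^ 2" by (rule one_le_power[OF w(2)])
    then have "C / \<bar>Im w\<bar> ^ 2 \<le> C / 1"
      using C(1) w(2) by (intro divide_left_mono) auto
    moreover have "norm (Gamma (of_real m - w)) \<le> C / \<bar>Im w\<bar> ^ 2" "norm (Gamma (- w)) \<le> C / \<bar>Im w\<bar> ^ 2"
      "norm (Gamma (1 + of_real n + w)) \<le> C / \<bar>Im w\<bar> ^ 2" "norm (Gamma (1 + w)) \<le> C / \<bar>Im w\<bar> ^ 2"
      using w C(2)[of "of_real m - w"] C(2)[of "- w"] C(2)[of "1 + of_real n + w"] C(2)[of "1 + w"] by auto
    ultimately have "norm (mellin_kernel m n w) \<le> (C / \<bar>Im w\<bar> ^ 2 * C) * (C * C)"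
      unfolding mellin_kernel_def norm_mult
      using C by (intro mult_mono mult_nonneg_nonneg norm_ge_zero) auto
    then show ?thesis by (simp add: power4_eq_xxxx mult_ac)
  qed
  with C(1) show ?thesis using that[of "C ^ 4"] by simp
qed

text \<open>All five arguments have positive real part: \<open>c < m\<close> and
  \<open>c < 0\<close> serve the first two, \<open>- 1/2 < c\<close> together with
  \<open>n > - 1/2\<close> the others.\<close>

lemma Gamma_args_line:
  assumes "Re s = c"
  shows "of_real m - s \<notin> \<int>\<^sub>\<le>\<^sub>0" "- s \<notin> \<int>\<^sub>\<le>\<^sub>0" "1 + of_real n + s \<notin> \<int>\<^sub>\<le>\<^sub>0" "1 + s \<notin> \<int>\<^sub>\<le>\<^sub>0" "1 / 2 + s \<notin> \<int>\<^sub>\<le>\<^sub>0"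
proof -
  have *: "z \<notin> \<int>\<^sub>\<le>\<^sub>0" if "Re z > 0" for z :: complex
    using that by (auto elim!: nonpos_Ints_cases)
  show "of_real m - s \<notin> \<int>\<^sub>\<le>\<^sub>0" "- s \<notin> \<int>\<^sub>\<le>\<^sub>0" "1 + of_real n + s \<notin> \<int>\<^sub>\<le>\<^sub>0" "1 + s \<notin> \<int>\<^sub>\<le>\<^sub>0" "1 / 2 + s \<notin> \<int>\<^sub>\<le>\<^sub>0"
    by (rule *; use assms mn c in simp)+
qed

lemma integrable_mellin_kernel: "integrable lborel (\<lambda>t. mellin_kernel m n (Complex c t))"
proof -
  obtain C where C: "\<And>w. \<bar>Re w\<bar> \<le> \<bar>c\<bar> \<Longrightarrow> \<bar>Im w\<bar> \<ge> 1 \<Longrightarrow> norm (mellin_kernel m n w) \<le> C / \<bar>Im w\<bar> ^ 2"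
    using mellin_kernel_bound[of "\<bar>c\<bar>"] by blast
  show ?thesis
  proof (rule integrable_if_bound_inverse_square)
    have cG: "continuous_on UNIV (\<lambda>t. Gamma (g t))"
      if "continuous_on UNIV g" "\<And>t. g t \<notin> \<int>\<^sub>\<le>\<^sub>0" for g :: "real \<Rightarrow> complex"
      by (rule continuous_on_compose2[OF continuous_on_Gamma[of "range g"] that(1)]) (use that(2) in auto)
    have "continuous_on UNIV (Complex c)"
      by (auto intro!: continuous_intros simp: Complex_eq)
    then show "continuous_on UNIV (\<lambda>t. mellin_kernel m n (Complex c t))"
      unfolding mellin_kernel_def
      by (intro continuous_on_mult cG continuous_on_diff continuous_on_add
            continuous_on_minus continuous_on_const Gamma_args_line; simp)
    show "norm (mellin_kernel m n (Complex c t)) \<le> C / t\<^sup>2" if "\<bar>t\<bar> \<ge> 1" for t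
      using C[of "Complex c t"] that by simp
  qed
qed

text \<open>For \<open>THE\<close> to denote this value, every separating path must lead to the same
  limit, and some separating path must exist.\<close>

lemma
  fixes x :: real and f :: "complex \<Rightarrow> complex"
  defines "f \<equiv> \<lambda>s. mellin_kernel m n s / (s + 1/2) * of_real x powr s"
  assumes x: "x > 0"
  shows meijer_G_eq_LBINT:
    "meijer_G 2 3 [of_real (- n), 1/2, 0] [of_real m, 0, - 1/2] (of_real x)
       = 1 / (2 * pi) * (\<integral>t. f (Complex c t) \<partial>lborel)" (is "meijer_G 2 3 ?as ?bs _ = _")
proof -
  let ?f = "meijer_integrand 2 3 ?as ?bs (of_real x)"
  \<comment> \<open>The only denominator factor comes from the parameter \<open>- 1/2\<close>.
    Written with \<open>rGamma\<close>, which is entire, it leaves only the poles of the numerator;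
    the identity holds at every \<open>s\<close> because of the defaults for \<open>Gamma\<close> at
    its poles and for division by 0.\<close>
  have f: "?f = (\<lambda>s. Gamma (of_real m - s) * Gamma (- s) * (Gamma (1 + of_real n + s) * Gamma (1 / 2 + s) * Gamma (1 + s))
      * rGamma (3 / 2 + s) * exp (s * of_real (ln x)))"
  proof
    fix s
    have "{3..<length ?as} = {}" "{2..<length ?bs} = {2}" "{..<2::nat} = {0, 1}" "{..<3::nat} = {0, 1, 2}"
      by auto
    then have "?f s = (Gamma (of_real m - s) * Gamma (- s) * (Gamma (1 + of_real n + s) * (Gamma (1 / 2 + s) * Gamma (1 + s))))
      / Gamma (3 / 2 + s) * exp (s * of_real (ln x))"
      using x by (simp add: meijer_integrand_def powr_def Ln_of_real)
    then show "?f s = Gamma (of_real m - s) * Gamma (- s) * (Gamma (1 + of_real n + s) * Gamma (1 / 2 + s) * Gamma (1 + s))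
      * rGamma (3 / 2 + s) * exp (s * of_real (ln x))"
      unfolding rGamma_inverse_Gamma by (simp only: divide_inverse mult.assoc)
  qed
  \<comment> \<open>The set \<open>L\<close> keeps the points \<open>- 3/2\<close>,
    \<open>- 5/2\<close> and so on, although \<open>1 / (s + 1/2)\<close> is regular there:
    \<open>Gamma (1 / 2 + s)\<close> takes its default \<open>0\<close> at these points, so the
    coded integrand need not be continuous there.\<close>
  define R L where "R = {s. of_real m - s \<in> \<int>\<^sub>\<le>\<^sub>0 \<or> 0 - s \<in> (\<int>\<^sub>\<le>\<^sub>0 :: complex set)}"
    and "L = {s. 1 + of_real n + s \<in> \<int>\<^sub>\<le>\<^sub>0 \<or> 1 / 2 + s \<in> \<int>\<^sub>\<le>\<^sub>0 \<or> 1 + s \<in> (\<int>\<^sub>\<le>\<^sub>0 :: complex set)}"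
  have meijer_path: "meijer_path 2 3 ?as ?bs \<gamma> \<longleftrightarrow>
      imag_infinity_path \<gamma> \<and> (\<forall>s\<in>R. right_of_path \<gamma> s) \<and> (\<forall>s\<in>L. left_of_path \<gamma> s)" for \<gamma>
    by (auto simp: meijer_path_def R_def L_def numeral_eq_Suc All_less_Suc)
  have R: "Im s = 0" "Re s > c" if "s \<in> R" for s
    using that c unfolding R_def by (auto elim!: nonpos_Ints_cases' simp: complex_eq_iff algebra_simps)
  have L: "Im s = 0" "Re s < c" if "s \<in> L" for s
    using that c mn unfolding L_def by (auto elim!: nonpos_Ints_cases' simp: complex_eq_iff algebra_simps)
  have closed: "closed (R \<union> L)"
  proof -
    have cl: "closed {s. g s \<in> (\<int>\<^sub>\<le>\<^sub>0 :: complex set)}" if "continuous_on UNIV g" for g :: "complex \<Rightarrow> complex"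
      using continuous_closed_preimage[OF that closed_UNIV closed_nonpos_Ints] by (simp add: vimage_def)
    show ?thesis
      unfolding R_def L_def Collect_disj_eq by (intro closed_Un cl continuous_intros)
  qed
  have finite: "finite {z \<in> R \<union> L. \<bar>Re z\<bar> \<le> B}" for B
  proof -
    have "{z \<in> R \<union> L. \<bar>Re z\<bar> \<le> B} \<subseteq> {s. of_real m - s \<in> \<int>\<^sub>\<le>\<^sub>0 \<and> \<bar>Re s\<bar> \<le> B} \<union> {s. 0 - s \<in> \<int>\<^sub>\<le>\<^sub>0 \<and> \<bar>Re s\<bar> \<le> B}
        \<union> {s. (1 + of_real n) + s \<in> \<int>\<^sub>\<le>\<^sub>0 \<and> \<bar>Re s\<bar> \<le> B} \<union> {s. 1 / 2 + s \<in> \<int>\<^sub>\<le>\<^sub>0 \<and> \<bar>Re s\<bar> \<le> B} \<union> {s. 1 + s \<in> \<int>\<^sub>\<le>\<^sub>0 \<and> \<bar>Re s\<bar> \<le> B}"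
      by (auto simp: R_def L_def)
    then show ?thesis
      by (rule finite_subset) (intro finite_UnI finite_nonpos_Int_translates finite_nonpos_Int_translates')
  qed
  have holo: "?f holomorphic_on - (R \<union> L)"
    unfolding f by (intro holomorphic_intros) (auto simp: R_def L_def)
  have fm: "?f s = mellin_kernel m n s / (s + 1/2) * of_real x powr s" if "1 / 2 + s \<notin> \<int>\<^sub>\<le>\<^sub>0" for s
  proof -
    have eq: "Gamma (3 / 2 + s) = (1 / 2 + s) * Gamma (1 / 2 + s)"
      using Gamma_plus1[OF that] by (simp add: algebra_simps)
    have nz: "Gamma (1 / 2 + s) \<noteq> 0" using that by (simp add: Gamma_eq_zero_iff)
    have "Gamma (1 / 2 + s) * rGamma (3 / 2 + s) = Gamma (1 / 2 + s) / ((1 / 2 + s) * Gamma (1 / 2 + s))"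
      unfolding rGamma_inverse_Gamma eq by (simp only: divide_inverse)
    also have "\<dots> = 1 / (1 / 2 + s)" using nz by simp
    finally have "Gamma (1 / 2 + s) * rGamma (3 / 2 + s) = 1 / (s + 1 / 2)" by (simp only: add.commute)
    moreover have "?f s = Gamma (of_real m - s) * Gamma (- s) * (Gamma (1 + of_real n + s) * Gamma (1 + s))
       * (Gamma (1 / 2 + s) * rGamma (3 / 2 + s)) * exp (s * of_real (ln x))"
      unfolding f by (simp only: mult_ac)
    ultimately show ?thesis using x by (simp add: mellin_kernel_def powr_def Ln_of_real)
  qed
  have decay: "\<exists>C. \<forall>w. \<bar>Re w\<bar> \<le> B \<longrightarrow> \<bar>Im w\<bar> \<ge> 1 \<longrightarrow> norm (?f w) \<le> C / \<bar>Im w\<bar> ^ 2" for B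
  proof -
    obtain C where C: "C > 0" "\<And>w. \<bar>Re w\<bar> \<le> B \<Longrightarrow> \<bar>Im w\<bar> \<ge> 1 \<Longrightarrow> norm (mellin_kernel m n w) \<le> C / \<bar>Im w\<bar> ^ 2"
      using mellin_kernel_bound[of B] by blast
    have "norm (?f w) \<le> C * exp (B * \<bar>ln x\<bar>) / \<bar>Im w\<bar> ^ 2" if w: "\<bar>Re w\<bar> \<le> B" "\<bar>Im w\<bar> \<ge> 1" for w
    proof -
      have nz: "1 / 2 + w \<notin> \<int>\<^sub>\<le>\<^sub>0" using w by (auto elim!: nonpos_Ints_cases simp: complex_eq_iff)
      have "1 \<le> norm (w + 1 / 2)" using abs_Im_le_cmod[of "w + 1 / 2"] w by simp
      moreover have "norm (of_real x powr w) \<le> exp (B * \<bar>ln x\<bar>)"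
      proof -
        have "Re w * ln x \<le> \<bar>Re w\<bar> * \<bar>ln x\<bar>" by (metis abs_ge_self abs_mult)
        also have "\<dots> \<le> B * \<bar>ln x\<bar>" using w by (intro mult_right_mono) auto
        finally show ?thesis using x by (simp add: powr_def Ln_of_real)
      qed
      ultimately have "norm (mellin_kernel m n w) / norm (w + 1 / 2) * norm (of_real x powr w)
         \<le> (C / \<bar>Im w\<bar> ^ 2) / 1 * exp (B * \<bar>ln x\<bar>)"
        using C(1) w by (intro mult_mono frac_le C(2)) auto
      then show ?thesis unfolding fm[OF nz] norm_mult norm_divide by simp
    qed
    then show ?thesis by blast
  qed
  have fc: "?f (Complex c t) = f (Complex c t)" for t
    unfolding f_def by (rule fm) (use Gamma_args_line(5)[of "Complex c t"] in simp)
  define G where "G = 1 / (2 * of_real pi) * (\<integral>t. f (Complex c t) \<partial>lborel)"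
  have lim: "((\<lambda>(r, s). 1 / (2 * of_real pi * \<i>) * contour_integral (subpath r s \<gamma>) ?f) \<longlongrightarrow> G) (at_bot \<times>\<^sub>F at_top)"
    if "meijer_path 2 3 ?as ?bs \<gamma>" for \<gamma>
  proof -
    have "((\<lambda>(r, s). contour_integral (subpath r s \<gamma>) ?f) \<longlongrightarrow> \<i> * (\<integral>t. ?f (Complex c t) \<partial>lborel)) (at_bot \<times>\<^sub>F at_top)"
      using that unfolding meijer_path
      by (intro imag_infinity_path_integral_tendsto(2)[OF closed holo _ finite decay])
         (use R L in \<open>force+\<close>)
    then have "((\<lambda>z. 1 / (2 * of_real pi * \<i>) * contour_integral (subpath (fst z) (snd z) \<gamma>) ?f)
       \<longlongrightarrow> 1 / (2 * of_real pi * \<i>) * (\<i> * (\<integral>t. ?f (Complex c t) \<partial>lborel))) (at_bot \<times>\<^sub>F at_top)"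
      unfolding case_prod_unfold by (intro tendsto_mult tendsto_const)
    then show ?thesis unfolding fc case_prod_unfold G_def by simp
  qed
  \<comment> \<open>This is the existence half: the line itself separates the poles.\<close>
  have vert: "meijer_path 2 3 ?as ?bs (Complex c)"
    unfolding meijer_path using R L
    by (auto intro: imag_infinity_path_vertical left_of_path_vertical right_of_path_vertical)
  have "meijer_G 2 3 ?as ?bs (of_real x) = G"
    unfolding meijer_G_def
  proof (rule the_equality)
    show "\<exists>\<gamma>. meijer_path 2 3 ?as ?bs \<gamma> \<and>
      ((\<lambda>(r, s). 1 / (2 * of_real pi * \<i>) * contour_integral (subpath r s \<gamma>) ?f) \<longlongrightarrow> G) (at_bot \<times>\<^sub>F at_top)"
      using vert lim by blast
    fix G' assume "\<exists>\<gamma>. meijer_path 2 3 ?as ?bs \<gamma> \<and>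
      ((\<lambda>(r, s). 1 / (2 * of_real pi * \<i>) * contour_integral (subpath r s \<gamma>) ?f) \<longlongrightarrow> G') (at_bot \<times>\<^sub>F at_top)"
    then obtain \<gamma> where "meijer_path 2 3 ?as ?bs \<gamma>"
      "((\<lambda>(r, s). 1 / (2 * of_real pi * \<i>) * contour_integral (subpath r s \<gamma>) ?f) \<longlongrightarrow> G') (at_bot \<times>\<^sub>F at_top)"
      by blast
    then show "G' = G"
      using lim[of \<gamma>] by (intro tendsto_unique[of "at_bot \<times>\<^sub>F at_top :: (real \<times> real) filter"]) (auto simp: prod_filter_eq_bot)
  qed
  then show ?thesis by (simp add: G_def)
qed

end

section \<open>The quotient of two variance-gamma variables\<close>

lemma (in prob_space) distributed_has_bochner_integral:
  fixes g :: "'b \<Rightarrow> 'c::{banach, second_countable_topology}"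
  assumes X: "distributed M N X (\<lambda>x. ennreal (f x))" and f: "f \<in> borel_measurable N" "\<And>x. f x \<ge> 0"
    and g: "g \<in> borel_measurable N" and I: "has_bochner_integral N (\<lambda>x. f x *\<^sub>R g x) I"
  shows "has_bochner_integral M (\<lambda>\<omega>. g (X \<omega>)) I"
proof -
  have X': "X \<in> measurable M N" and D: "distr M N X = density N (\<lambda>x. ennreal (f x))"
    using X by (auto simp: distributed_def)
  have "has_bochner_integral (distr M N X) g I"
    unfolding D using I f g by (simp add: has_bochner_integral_iff integrable_density integral_density)
  then show ?thesis
    using X' g by (simp add: has_bochner_integral_iff integrable_distr_eq integral_distr)
qed

lemma (in prob_space) AE_distributed_lborel_neq:
  assumes "distributed M lborel X f"
  shows "AE \<omega> in M. X \<omega> \<noteq> (a :: real)"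
proof -
  have "AE x in density lborel f. x \<noteq> a"
    using assms AE_lborel_singleton[of a] by (subst AE_density) (auto simp: distributed_def elim: eventually_mono)
  moreover have "distr M lborel X = density lborel f" using assms by (simp add: distributed_def)
  ultimately have "AE x in distr M lborel X. x \<noteq> a" by (simp only:)
  then show ?thesis
    using assms by (subst (asm) AE_distr_iff) (auto simp: distributed_def)
qed

text \<open>For fixed \<open>y\<close> the event \<open>X = k * y\<close> is null because
  \<open>X\<close> has no atoms; independence makes the joint law a product, so Fubini applies. From
  this both \<open>X / Y\<close> and \<open>L\<close> inherit the absence of atoms.\<close>

lemma (in prob_space) AE_indep_neq_mult:
  fixes X Y :: "'a \<Rightarrow> real"
  assumes indep: "indep_var borel X borel Y" and X: "\<And>a. AE \<omega> in M. X \<omega> \<noteq> a"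
  shows "AE \<omega> in M. X \<omega> \<noteq> k * Y \<omega>"
proof -
  have [measurable]: "X \<in> borel_measurable M" "Y \<in> borel_measurable M"
    using indep by (auto dest: indep_var_rv1 indep_var_rv2)
  interpret DX: prob_space "distr M borel X" by (rule prob_space_distr) simp
  interpret DY: prob_space "distr M borel Y" by (rule prob_space_distr) simp
  interpret P: pair_prob_space "distr M borel X" "distr M borel Y" ..
  have "AE y in distr M borel Y. AE x in distr M borel X. x \<noteq> k * y"
    using X by (simp add: AE_distr_iff)
  then have "AE x in distr M borel X. AE y in distr M borel Y. x \<noteq> k * y"
    by (subst P.AE_commute) measurable
  then have "AE z in distr M borel X \<Otimes>\<^sub>M distr M borel Y. case z of (x, y) \<Rightarrow> x \<noteq> k * y"
  proof (intro P.AE_pair_measure)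
    show "{z \<in> space (distr M borel X \<Otimes>\<^sub>M distr M borel Y). case z of (x, y) \<Rightarrow> x \<noteq> k * y}
        \<in> sets (distr M borel X \<Otimes>\<^sub>M distr M borel Y)" by measurable
  qed simp
  moreover have "distr M borel X \<Otimes>\<^sub>M distr M borel Y = distr M (borel \<Otimes>\<^sub>M borel) (\<lambda>\<omega>. (X \<omega>, Y \<omega>))"
    using indep unfolding indep_var_distribution_eq by simp
  ultimately have "AE z in distr M (borel \<Otimes>\<^sub>M borel) (\<lambda>\<omega>. (X \<omega>, Y \<omega>)). case z of (x, y) \<Rightarrow> x \<noteq> k * y"
    by (simp only:)
  then show ?thesis by (subst (asm) AE_distr_iff) auto
qed

text \<open>By independence the law of the quotient depends only on the two marginals, and
  \<open>- (X / Y)\<close> is the quotient of \<open>- X\<close> and \<open>Y\<close>.\<close>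

lemma (in prob_space) distr_quotient_symmetric:
  fixes X Y :: "'a \<Rightarrow> real"
  assumes indep: "indep_var borel X borel Y" and sym: "distr M borel (\<lambda>\<omega>. - X \<omega>) = distr M borel X"
  shows "distr M borel (\<lambda>\<omega>. - (X \<omega> / Y \<omega>)) = distr M borel (\<lambda>\<omega>. X \<omega> / Y \<omega>)"
proof -
  have [measurable]: "X \<in> borel_measurable M" "Y \<in> borel_measurable M"
    using indep by (auto dest: indep_var_rv1 indep_var_rv2)
  have indep': "indep_var borel (\<lambda>\<omega>. - X \<omega>) borel Y"
    using indep_var_compose[OF indep, of uminus borel id borel] by (simp add: o_def)
  have *: "distr M borel (\<lambda>\<omega>. U \<omega> / Y \<omega>) = distr (distr M borel U \<Otimes>\<^sub>M distr M borel Y) borel (\<lambda>(x, y). x / y)"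
    if "indep_var borel U borel Y" for U :: "'a \<Rightarrow> real"
  proof -
    have [measurable]: "U \<in> borel_measurable M" using that by (auto dest: indep_var_rv1)
    have "distr M borel U \<Otimes>\<^sub>M distr M borel Y = distr M (borel \<Otimes>\<^sub>M borel) (\<lambda>\<omega>. (U \<omega>, Y \<omega>))"
      using that unfolding indep_var_distribution_eq by simp
    then show ?thesis by (simp add: distr_distr o_def)
  qed
  show ?thesis using *[OF indep'] *[OF indep] sym by simp
qed

lemma (in real_distribution) symmetric_prob:
  assumes sym: "distr M borel uminus = M" and atomless: "\<And>a. prob {a} = 0"
  shows prob_atMost_uminus: "prob {..- z} = 1 - prob {..z}"
    and prob_symmetric_interval: "z \<ge> 0 \<Longrightarrow> prob {- z..z} = 2 * prob {..z} - 1"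
proof -
  have lt: "prob {..<z} = prob {..z}" for z
  proof -
    have "prob {..z} = prob ({..<z} \<union> {z})" by (rule arg_cong[of _ _ prob]) auto
    also have "\<dots> = prob {..<z} + prob {z}" by (rule finite_measure_Union) auto
    finally show ?thesis using atomless[of z] by simp
  qed
  show *: "prob {..- z} = 1 - prob {..z}" for z
  proof -
    have "prob {..- z} = measure (distr M borel uminus) {..- z}" by (simp add: sym)
    also have "\<dots> = prob (uminus -` {..- z} \<inter> space M)" by (rule measure_distr) auto
    also have "uminus -` {..- z} \<inter> space M = space M - {..<z}" by auto
    also have "prob (space M - {..<z}) = 1 - prob {..<z}" by (rule prob_compl) simp
    finally show ?thesis by (simp add: lt)
  qed
  assume "z \<ge> 0"
  then have "{..z} = {..<- z} \<union> {- z..z}" by auto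
  then have "prob {..z} = prob {..<- z} + prob {- z..z}"
    by (simp only:) (rule finite_measure_Union; auto)
  then show "prob {- z..z} = 2 * prob {..z} - 1" by (simp add: lt *)
qed

lemma (in prob_space) vg_quotient_abs_cdf:
  fixes X Y :: "'a \<Rightarrow> real"
  assumes mn: "m > - 1/2" "n > - 1/2" and \<alpha>: "\<alpha>\<^sub>1 > 0" "\<alpha>\<^sub>2 > 0"
    and X: "distributed M lborel X (\<lambda>x. ennreal (vg_density m \<alpha>\<^sub>1 x))"
    and Y: "distributed M lborel Y (\<lambda>y. ennreal (vg_density n \<alpha>\<^sub>2 y))"
    and indep: "indep_var borel X borel Y" and z: "z > 0"
  shows "complex_of_real (prob {\<omega> \<in> space M. \<bar>X \<omega> / Y \<omega>\<bar> \<le> z})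
    = of_real ((\<alpha>\<^sub>1 * z / \<alpha>\<^sub>2) / (pi * Gamma (m + 1/2) * Gamma (n + 1/2)))
       * meijer_G 2 3 [of_real (- n), 1/2, 0] [of_real m, 0, - 1/2] (of_real ((\<alpha>\<^sub>1 * z / \<alpha>\<^sub>2)\<^sup>2))"
proof -
  \<comment> \<open>any \<open>c\<close> strictly between \<open>- 1/2\<close> and \<open>min m 0\<close> works\<close>
  define c where "c = (min m 0 - 1/2) / 2"
  have c: "- 1/2 < c" "c < m" "c < 0" using mn by (auto simp: c_def min_def)
  \<comment> \<open>With \<open>s = c - \<i> * t / 2\<close> this choice gives
    \<open>k - \<i> * t = 2 * (s + 1/2)\<close>.\<close>
  define k where "k = 2 * c + 1"
  have k: "k > 0" using c by (simp add: k_def)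
  define w where "w = \<alpha>\<^sub>1 * z / \<alpha>\<^sub>2"
  have w: "w > 0" using \<alpha> z by (simp add: w_def)
  define L where "L = (\<lambda>\<omega>. ln (\<alpha>\<^sub>1 * \<bar>X \<omega>\<bar>) - ln (\<alpha>\<^sub>2 * \<bar>Y \<omega>\<bar>))"
  have [measurable]: "X \<in> borel_measurable M" "Y \<in> borel_measurable M"
    using indep by (auto dest: indep_var_rv1 indep_var_rv2)
  have L[measurable]: "L \<in> borel_measurable M" unfolding L_def by measurable
  have Xnz: "AE \<omega> in M. X \<omega> \<noteq> 0" and Ynz: "AE \<omega> in M. Y \<omega> \<noteq> 0"
    by (rule AE_distributed_lborel_neq[OF X] AE_distributed_lborel_neq[OF Y])+
  interpret D: real_distribution "distr M borel L" by (rule real_distribution_distr) simp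
  define K where "K = pi * Gamma (m + 1/2) * Gamma (n + 1/2)"
  have mell: "has_bochner_integral M (\<lambda>\<omega>. exp ((\<i> * of_real t - of_real k) * complex_of_real (L \<omega>)))
      (mellin_kernel m n (Complex c (- t / 2)) / of_real K)" for t
  proof -
    define u where "u = \<i> * complex_of_real t - of_real k"
    \<comment> \<open>Here \<open>Re u = - (2 * c + 1)\<close>, so the two conditions for
      \<open>X\<close> are exactly \<open>c < 0\<close> and \<open>c < m\<close>. Those for
      \<open>Y\<close> hold since \<open>- u\<close> has positive real part.\<close>
    have u: "Re u > - 1" "Re u > - 1 - 2 * m" "Re (- u) > - 1" "Re (- u) > - 1 - 2 * n"
      using c mn by (auto simp: u_def k_def)
    define gX gY where "gX = (\<lambda>x. exp (u * complex_of_real (ln (\<alpha>\<^sub>1 * \<bar>x\<bar>))))"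
      and "gY = (\<lambda>y. exp (- u * complex_of_real (ln (\<alpha>\<^sub>2 * \<bar>y\<bar>))))"
    have [measurable]: "gX \<in> borel_measurable borel" "gY \<in> borel_measurable borel"
      unfolding gX_def gY_def by measurable
    have IX: "has_bochner_integral M (\<lambda>\<omega>. gX (X \<omega>)) (exp (u * of_real (ln 2)) * Gamma ((u + 1) / 2) * Gamma (of_real m + (u + 1) / 2)
       / of_real (sqrt pi * Gamma (m + 1/2)))"
    proof (rule distributed_has_bochner_integral[OF X])
      show "has_bochner_integral lborel (\<lambda>x. vg_density m \<alpha>\<^sub>1 x *\<^sub>R gX x) (exp (u * of_real (ln 2)) * Gamma ((u + 1) / 2) * Gamma (of_real m + (u + 1) / 2)
         / of_real (sqrt pi * Gamma (m + 1/2)))"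
        unfolding gX_def by (rule has_bochner_integral_vg_density[OF \<alpha>(1) u(1,2)])
    qed (auto intro: vg_density_nonneg mn)
    have IY: "has_bochner_integral M (\<lambda>\<omega>. gY (Y \<omega>)) (exp (- u * of_real (ln 2)) * Gamma ((- u + 1) / 2) * Gamma (of_real n + (- u + 1) / 2)
       / of_real (sqrt pi * Gamma (n + 1/2)))"
    proof (rule distributed_has_bochner_integral[OF Y])
      show "has_bochner_integral lborel (\<lambda>y. vg_density n \<alpha>\<^sub>2 y *\<^sub>R gY y) (exp (- u * of_real (ln 2)) * Gamma ((- u + 1) / 2) * Gamma (of_real n + (- u + 1) / 2)
         / of_real (sqrt pi * Gamma (n + 1/2)))"
        unfolding gY_def by (rule has_bochner_integral_vg_density[OF \<alpha>(2) u(3,4)])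
    qed (auto intro: vg_density_nonneg mn)
    have indep': "indep_var borel (\<lambda>\<omega>. gX (X \<omega>)) borel (\<lambda>\<omega>. gY (Y \<omega>))"
      using indep_var_compose[OF indep, of gX borel gY borel] by (simp add: o_def)
    have int: "integrable M (\<lambda>\<omega>. gX (X \<omega>))" "integrable M (\<lambda>\<omega>. gY (Y \<omega>))"
      using IX IY by (auto simp: has_bochner_integral_iff)
    have prod: "gX (X \<omega>) * gY (Y \<omega>) = exp ((\<i> * of_real t - of_real k) * complex_of_real (L \<omega>))" for \<omega>
      by (simp add: gX_def gY_def L_def u_def algebra_simps flip: exp_add)
    have "has_bochner_integral M (\<lambda>\<omega>. gX (X \<omega>) * gY (Y \<omega>)) (integral\<^sup>L M (\<lambda>\<omega>. gX (X \<omega>)) * integral\<^sup>L M (\<lambda>\<omega>. gY (Y \<omega>)))"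
      using indep_var_integrable[OF indep' int] indep_var_lebesgue_integral[OF indep' int]
      by (simp add: has_bochner_integral_iff)
    also have "integral\<^sup>L M (\<lambda>\<omega>. gX (X \<omega>)) * integral\<^sup>L M (\<lambda>\<omega>. gY (Y \<omega>)) = mellin_kernel m n (Complex c (- t / 2)) / of_real K"
    proof -
      have s: "(u + 1) / 2 = - Complex c (- t / 2)" "(- u + 1) / 2 = 1 + Complex c (- t / 2)"
        by (simp_all add: u_def k_def complex_eq_iff field_simps)
      \<comment> \<open>The powers of 2 in the two moments cancel because \<open>X\<close> and
        \<open>Y\<close> enter with opposite exponents.\<close>
      have e: "exp (u * of_real (ln 2)) * exp (- u * of_real (ln 2)) = 1"
        by (simp flip: exp_add)
      have p: "complex_of_real (sqrt pi) * of_real (sqrt pi) = of_real pi"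
        by (simp flip: of_real_mult)
      have "integral\<^sup>L M (\<lambda>\<omega>. gX (X \<omega>)) * integral\<^sup>L M (\<lambda>\<omega>. gY (Y \<omega>))
        = (exp (u * of_real (ln 2)) * exp (- u * of_real (ln 2))) * (Gamma ((u + 1) / 2) * Gamma (of_real m + (u + 1) / 2) *
          (Gamma ((- u + 1) / 2) * Gamma (of_real n + (- u + 1) / 2)))
           / (complex_of_real (sqrt pi) * of_real (sqrt pi) * of_real (Gamma (m + 1/2)) * of_real (Gamma (n + 1/2)))"
        using has_bochner_integral_integral_eq[OF IX] has_bochner_integral_integral_eq[OF IY]
        by (simp add: mult_ac)
      then show ?thesis
        unfolding e p s by (simp add: mellin_kernel_def K_def mult_ac add_ac)
    qed
    finally show ?thesis unfolding prod .
  qed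
  define \<Phi> where "\<Phi> = (\<lambda>t. \<integral>x. exp ((\<i> * of_real t - of_real k) * complex_of_real x) \<partial>distr M borel L)"
  have \<Phi>: "\<Phi> t = mellin_kernel m n (Complex c (- t / 2)) / of_real K" for t
    unfolding \<Phi>_def using has_bochner_integral_integral_eq[OF mell[of t]] by (subst integral_distr) auto
  have atomless: "D.prob {a} = 0" for a
  proof -
    \<comment> \<open>Solving \<open>L = a\<close> gives
      \<open>\<bar>X\<bar> = q * \<bar>Y\<bar>\<close>, so the event lies in the union of two null
      events with slopes \<open>q\<close> and \<open>- q\<close>, up to zeros of \<open>X\<close>
      and \<open>Y\<close>.\<close>
    define q where "q = exp a * \<alpha>\<^sub>2 / \<alpha>\<^sub>1"
    have "AE \<omega> in M. X \<omega> \<noteq> r * Y \<omega>" for r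
      by (rule AE_indep_neq_mult[OF indep AE_distributed_lborel_neq[OF X]])
    from this[of q] this[of "- q"] Xnz Ynz have "AE \<omega> in M. L \<omega> \<noteq> a"
    proof eventually_elim
      case (elim \<omega>)
      show ?case
      proof
        assume "L \<omega> = a"
        then have "exp (ln (\<alpha>\<^sub>1 * \<bar>X \<omega>\<bar>)) = exp (a + ln (\<alpha>\<^sub>2 * \<bar>Y \<omega>\<bar>))" by (simp add: L_def)
        then have "\<alpha>\<^sub>1 * \<bar>X \<omega>\<bar> = exp a * (\<alpha>\<^sub>2 * \<bar>Y \<omega>\<bar>)" using \<alpha> elim by (simp add: exp_add)
        then have "\<bar>X \<omega>\<bar> = q * \<bar>Y \<omega>\<bar>" using \<alpha> by (simp add: q_def field_simps)
        then have "X \<omega> = q * Y \<omega> \<or> X \<omega> = - q * Y \<omega>" by (auto simp: abs_if split: if_splits)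
        with elim show False by blast
      qed
    qed
    then have "prob (L -` {a} \<inter> space M) = 0"
      by (subst prob_eq_0) (auto elim: eventually_mono)
    then show ?thesis by (simp add: measure_distr)
  qed
  have moment: "integrable (distr M borel L) (\<lambda>x. exp (- k * x))"
  proof -
    have "integrable M (\<lambda>\<omega>. norm (exp ((\<i> * of_real 0 - of_real k) * complex_of_real (L \<omega>))))"
      using mell[of 0] by (intro integrable_norm) (simp add: has_bochner_integral_iff)
    then have "integrable M (\<lambda>\<omega>. exp (- k * L \<omega>))" by simp
    then show ?thesis by (subst integrable_distr_eq) auto
  qed
  have kint: "integrable lborel (\<lambda>t. mellin_kernel m n (Complex c t))"
    by (rule integrable_mellin_kernel[OF mn c])
  have int\<Phi>: "integrable lborel \<Phi>"
    unfolding \<Phi> using lborel_integrable_real_affine[OF kint, of "- 1/2" 0] by simp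
  define f where "f = (\<lambda>s. mellin_kernel m n s / (s + 1/2) * of_real (w\<^sup>2) powr s)"
  have "complex_of_real (D.prob {..ln w}) = 1 / (2 * pi) * (\<integral>t. \<Phi> t * (exp ((of_real k - \<i> * of_real t) * of_real (ln w)) / (of_real k - \<i> * of_real t)) \<partial>lborel)"
    using D.prob_atMost_eq_inversion_integral[OF k atomless moment, of "ln w"] int\<Phi> unfolding \<Phi>_def by simp
  \<comment> \<open>Replacing \<open>t\<close> by \<open>- 2 * t\<close> turns the argument
    \<open>- t / 2\<close> of the kernel into \<open>t\<close>. The Jacobian 2 cancels the 2 in
    \<open>2 * (s + 1/2)\<close>.\<close>
  also have "(\<integral>t. \<Phi> t * (exp ((of_real k - \<i> * of_real t) * of_real (ln w)) / (of_real k - \<i> * of_real t)) \<partial>lborel)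
     = 2 *\<^sub>R (\<integral>t. \<Phi> (0 + (- 2) * t) * (exp ((of_real k - \<i> * of_real (0 + (- 2) * t)) * of_real (ln w)) / (of_real k - \<i> * of_real (0 + (- 2) * t))) \<partial>lborel)"
    by (subst lborel_integral_real_affine[where c="- 2" and t=0]) simp_all
  also have "(\<lambda>t. \<Phi> (0 + (- 2) * t) * (exp ((of_real k - \<i> * of_real (0 + (- 2) * t)) * of_real (ln w)) / (of_real k - \<i> * of_real (0 + (- 2) * t))))
     = (\<lambda>t. of_real (w / (2 * K)) * f (Complex c t))"
  proof
    fix t
    define s where "s = Complex c t"
    have s: "of_real k - \<i> * of_real (0 + (- 2) * t) = 2 * (s + 1/2)"
      by (simp add: s_def k_def complex_eq_iff)
    \<comment> \<open>This is the origin of both the prefactor \<open>w\<close> and the squared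
      argument of the G-function.\<close>
    have "exp (2 * (s + 1/2) * of_real (ln w)) = exp (of_real (ln w)) * exp (s * of_real (2 * ln w))"
      by (simp add: algebra_simps flip: exp_add)
    also have "exp (complex_of_real (ln w)) = of_real w" unfolding exp_of_real using w by simp
    also have "exp (s * of_real (2 * ln w)) = of_real (w\<^sup>2) powr s"
      using w by (simp add: powr_def Ln_of_real ln_realpow flip: of_real_power)
    finally have "exp (2 * (s + 1/2) * of_real (ln w)) = of_real w * of_real (w\<^sup>2) powr s" .
    then have "\<Phi> (0 + (- 2) * t) * (exp (2 * (s + 1/2) * of_real (ln w)) / (2 * (s + 1/2)))
      = mellin_kernel m n s / of_real K * (of_real w * of_real (w\<^sup>2) powr s / (2 * (s + 1/2)))"
      by (simp add: \<Phi> s_def)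
    also have "\<dots> = of_real (w / (2 * K)) * f s"
    proof -
      have "A / B * (C * E / (2 * F)) = C / (2 * B) * (A / F * E)" for A B C E F :: complex
        by (simp add: mult_ac)
      then show ?thesis unfolding f_def of_real_divide of_real_mult of_real_numeral .
    qed
    finally show "\<Phi> (0 + (- 2) * t) * (exp ((of_real k - \<i> * of_real (0 + (- 2) * t)) * of_real (ln w)) / (of_real k - \<i> * of_real (0 + (- 2) * t)))
       = of_real (w / (2 * K)) * f (Complex c t)"
      unfolding s s_def .
  qed
  also have "1 / (2 * pi) * (2 *\<^sub>R (\<integral>t. of_real (w / (2 * K)) * f (Complex c t) \<partial>lborel))
     = of_real (w / K) * (1 / (2 * pi) * (\<integral>t. f (Complex c t) \<partial>lborel))"
    by (simp add: scaleR_conv_of_real)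
  also have "1 / (2 * pi) * (\<integral>t. f (Complex c t) \<partial>lborel)
      = meijer_G 2 3 [of_real (- n), 1/2, 0] [of_real m, 0, - 1/2] (of_real (w\<^sup>2))"
    unfolding f_def using w by (intro meijer_G_eq_LBINT[OF mn c, symmetric]) simp
  also have "D.prob {..ln w} = prob {\<omega> \<in> space M. \<bar>X \<omega> / Y \<omega>\<bar> \<le> z}"
  proof -
    have "D.prob {..ln w} = prob (L -` {..ln w} \<inter> space M)" by (simp add: measure_distr)
    also have "\<dots> = prob {\<omega> \<in> space M. \<bar>X \<omega> / Y \<omega>\<bar> \<le> z}"
    \<comment> \<open>The two events may differ where \<open>X\<close> or \<open>Y\<close> vanishes
      and \<open>ln\<close> or the division takes a default value; this is a null set.\<close>
    proof (rule finite_measure_eq_AE)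
      show "AE \<omega> in M. (\<omega> \<in> L -` {..ln w} \<inter> space M) = (\<omega> \<in> {\<omega> \<in> space M. \<bar>X \<omega> / Y \<omega>\<bar> \<le> z})"
        using Xnz Ynz AE_space
      proof eventually_elim
        case (elim \<omega>)
        have "L \<omega> \<le> ln w \<longleftrightarrow> ln (\<alpha>\<^sub>1 * \<bar>X \<omega>\<bar>) \<le> ln (w * (\<alpha>\<^sub>2 * \<bar>Y \<omega>\<bar>))"
          using w \<alpha> elim by (simp add: L_def ln_mult_pos algebra_simps)
        also have "\<dots> \<longleftrightarrow> \<alpha>\<^sub>1 * \<bar>X \<omega>\<bar> \<le> w * (\<alpha>\<^sub>2 * \<bar>Y \<omega>\<bar>)"
          using w \<alpha> elim by (intro ln_le_cancel_iff) auto
        also have "\<dots> \<longleftrightarrow> \<bar>X \<omega> / Y \<omega>\<bar> \<le> z"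
          using \<alpha> elim by (simp add: w_def field_simps)
        finally show ?case using elim by simp
      qed
    qed measurable
    finally show ?thesis .
  qed
  finally show ?thesis by (simp add: w_def K_def)
qed

theorem theorem2p6:
  fixes M :: "'a measure" and X Y :: "'a \<Rightarrow> real"
    and m n \<alpha>\<^sub>1 \<alpha>\<^sub>2 :: real and T :: "real \<Rightarrow> complex"
  assumes "m > - 1/2" and "n > - 1/2" and "\<alpha>\<^sub>1 > 0" and "\<alpha>\<^sub>2 > 0"
    and "prob_space M"
    and "distributed M lborel X (\<lambda>x. ennreal (vg_density m \<alpha>\<^sub>1 x))"
    and "distributed M lborel Y (\<lambda>y. ennreal (vg_density n \<alpha>\<^sub>2 y))"
    and "prob_space.indep_var M borel X borel Y"
  defines "T \<equiv> \<lambda>z. of_real ((\<alpha>\<^sub>1 * z / \<alpha>\<^sub>2) / (2 * pi * Gamma (m + 1/2) * Gamma (n + 1/2)))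
              * meijer_G 2 3 [of_real (- n), 1/2, 0] [of_real m, 0, - 1/2]
                  (of_real (\<alpha>\<^sub>1\<^sup>2 * z\<^sup>2 / \<alpha>\<^sub>2\<^sup>2))"
  shows "(T \<longlongrightarrow> 0) (at 0) \<and>
         (\<forall>z::real. of_real (\<P>(\<omega> in M. X \<omega> / Y \<omega> \<le> z))
                      = 1/2 + (if z = 0 then 0 else T z))"
proof -
  interpret prob_space M by fact
  note X = assms(6) and Y = assms(7) and indep = assms(8)
  have XM [measurable]: "X \<in> borel_measurable M" "Y \<in> borel_measurable M"
    using indep by (auto dest: indep_var_rv1 indep_var_rv2)
  define Z where "Z = (\<lambda>\<omega>. X \<omega> / Y \<omega>)"
  have Z [measurable]: "Z \<in> borel_measurable M" unfolding Z_def by measurable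
  interpret D: real_distribution "distr M borel Z" by (rule real_distribution_distr) simp
  have DZ: "D.prob A = prob (Z -` A \<inter> space M)" if "A \<in> sets borel" for A
    using that by (simp add: measure_distr)
  \<comment> \<open>The density is even and Lebesgue measure is invariant under reflection, hence
    \<open>X\<close> is symmetric.\<close>
  have "distr M lborel (\<lambda>\<omega>. - X \<omega>) = distr M lborel X"
  proof -
    have meas: "(\<lambda>x. ennreal (vg_density m \<alpha>\<^sub>1 x)) \<in> borel_measurable borel" by measurable
    have "distr M lborel (\<lambda>\<omega>. - X \<omega>) = distr (distr M lborel X) lborel uminus"
      by (simp add: distr_distr o_def)
    also have "distr M lborel X = density lborel (\<lambda>x. ennreal (vg_density m \<alpha>\<^sub>1 x))"
      using X by (simp add: distributed_def)
    also have "distr (density lborel (\<lambda>x. ennreal (vg_density m \<alpha>\<^sub>1 x))) lborel uminus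
       = density (distr lborel lborel uminus) (\<lambda>x. ennreal (vg_density m \<alpha>\<^sub>1 x))"
      using meas by (subst density_distr) simp_all
    also have "distr lborel lborel uminus = (lborel :: real measure)"
      using lborel_distr_uminus by (simp cong: distr_cong)
    also have "density lborel (\<lambda>x. ennreal (vg_density m \<alpha>\<^sub>1 x)) = distr M lborel X"
      using X by (simp add: distributed_def)
    finally show ?thesis .
  qed
  then have "distr M borel (\<lambda>\<omega>. - X \<omega>) = distr M borel X" by (simp cong: distr_cong)
  from distr_quotient_symmetric[OF indep this]
  have sym: "distr (distr M borel Z) borel uminus = distr M borel Z"
    by (simp add: distr_distr o_def Z_def)
  have atomless: "D.prob {a} = 0" for a
  proof -
    have "AE \<omega> in M. X \<omega> \<noteq> a * Y \<omega>"
      by (rule AE_indep_neq_mult[OF indep AE_distributed_lborel_neq[OF X]])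
    with AE_distributed_lborel_neq[OF Y, of 0] have "AE \<omega> in M. Z \<omega> \<noteq> a"
      by eventually_elim (auto simp: Z_def)
    then have "prob (Z -` {a} \<inter> space M) = 0"
      by (subst prob_eq_0) (auto elim: eventually_mono)
    then show ?thesis by (simp add: DZ)
  qed
  have prob: "\<P>(\<omega> in M. X \<omega> / Y \<omega> \<le> z) = D.prob {..z}" for z
    unfolding DZ[OF atMost_borel] by (rule arg_cong[of _ _ prob]) (auto simp: Z_def)
  have pos: "complex_of_real (D.prob {..z}) = 1/2 + T z" if "z > 0" for z
  proof -
    have "D.prob {- z..z} = prob {\<omega> \<in> space M. \<bar>X \<omega> / Y \<omega>\<bar> \<le> z}"
      by (subst DZ) (auto simp: Z_def abs_le_iff simp del: abs_divide intro!: arg_cong[of _ _ prob])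
    \<comment> \<open>The prefactor of \<open>T\<close> has \<open>2 * pi\<close> where the
      distribution function of the absolute value has \<open>pi\<close>.\<close>
    then have "complex_of_real (D.prob {- z..z}) = 2 * T z"
      using vg_quotient_abs_cdf[OF assms(1-4) X Y indep that]
      by (simp add: T_def power_mult_distrib power_divide mult.assoc)
    moreover have "D.prob {- z..z} = 2 * D.prob {..z} - 1"
      using that by (intro D.prob_symmetric_interval[OF sym atomless]) simp
    ultimately have "2 * complex_of_real (D.prob {..z}) - 1 = 2 * T z"
      by (metis of_real_1 of_real_diff of_real_mult of_real_numeral)
    then show ?thesis by (simp add: field_simps)
  qed
  \<comment> \<open>The G-function sees only the square of \<open>z\<close>, so \<open>T\<close> is
    odd; with the symmetry of the law this covers negative \<open>z\<close>.\<close>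
  have T_minus: "T (- z) = - T z" for z by (simp add: T_def)
  have zero: "D.prob {..0} = 1/2" using D.prob_atMost_uminus[OF sym atomless, of 0] by simp
  have eq: "complex_of_real (D.prob {..z}) = 1/2 + (if z = 0 then 0 else T z)" for z
  proof (cases z "0 :: real" rule: linorder_cases)
    case less
    have "D.prob {..z} = 1 - D.prob {..- z}" using D.prob_atMost_uminus[OF sym atomless, of "- z"] by simp
    then have "complex_of_real (D.prob {..z}) = 1 - (1/2 + T (- z))" using pos[of "- z"] less by simp
    then show ?thesis using less by (simp add: T_minus)
  next
    case equal
    have "complex_of_real (D.prob {..0}) = 1/2" unfolding zero by simp
    then show ?thesis using equal by simp
  qed (use pos in auto)
  \<comment> \<open>Off 0, \<open>T\<close> is the distribution function minus 1/2, so its limit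
    follows from the absence of an atom at 0.\<close>
  have "isCont (cdf (distr M borel Z)) 0"
    using atomless[of 0] by (simp add: D.isCont_cdf)
  then have "((\<lambda>z. D.prob {..z}) \<longlongrightarrow> 1/2) (at 0)"
    by (simp add: isCont_def cdf_def zero)
  then have "((\<lambda>z. complex_of_real (D.prob {..z}) - 1/2) \<longlongrightarrow> of_real (1/2) - 1/2) (at 0)"
    by (intro tendsto_diff tendsto_of_real tendsto_const)
  moreover have "eventually (\<lambda>z. complex_of_real (D.prob {..z}) - 1/2 = T z) (at 0)"
    unfolding eventually_at_filter by (rule always_eventually) (simp add: eq)
  ultimately have "(T \<longlongrightarrow> of_real (1/2) - 1/2) (at 0)" by (rule Lim_transform_eventually)
  then have "(T \<longlongrightarrow> 0) (at 0)" by simp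
  then show ?thesis unfolding prob using eq by blast
qed

end
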